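(* Let $k\ge 1$ be an integer, let $(X,\mathcal{B},\mu)$ be a Lebesgue probability space, and let $T_1,\dots,T_k$ be pairwise commuting, invertible, bi-measurable, $\mu$-preserving transformations of $X$. Assume that each $T_i$ is weakly mixing and that for any $i\ne j$ the map $T_i\circ T_j^{-1}$ is ergodic. Then there is a strictly increasing sequence of positive integers $(N_l)_{l\ge1}$ such that for every $f_1,\dots,f_k\in L^\infty(\mu)$, the averages $$\frac1{N_l}\sum_{n=1}^{N_l}\prod_{i=1}^{k}f_i(T_i^n x)$$ converge, as $l\to\infty$, to $\prod_{j=1}^{k}\int f_j\,d\mu$ for $\mu$-almost every $x\in X$.
   Context: A Lebesgue probability space is a Polish space $X$ with its Borel $\sigma$-algebra $\mathcal{B}$ completed with respect to a probability measure $\mu$; only non-atomic Lebesgue spaces are considered. The sequence $(N_l)$ does not depend on the functions $f_1,\dots,f_k$. *)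

theory Defs
  imports "HOL-Probability.Probability"
begin

text \<open>The type class \<^class>\<open>polish_space\<close> carries a complete metric, but only the Borel sets of
  the induced topology are used below. Atoms are meant in the measure-theoretic sense: sets of
  positive measure without measurable subsets of strictly smaller positive measure.\<close>

definition nonatomic :: "'a measure \<Rightarrow> bool" where
  "nonatomic M \<longleftrightarrow>
     (\<forall>A\<in>sets M. 0 < emeasure M A \<longrightarrow>
        (\<exists>B\<in>sets M. B \<subseteq> A \<and> 0 < emeasure M B \<and> emeasure M B < emeasure M A))"

definition lebesgue_prob_space :: "'a::polish_space measure \<Rightarrow> bool" where
  "lebesgue_prob_space M \<longleftrightarrow>
     (\<exists>P. prob_space P \<and> sets P = sets borel \<and> M = completion P) \<and> nonatomic M"

definition measure_preserving :: "'a measure \<Rightarrow> ('a \<Rightarrow> 'a) \<Rightarrow> bool" where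
  "measure_preserving M T \<longleftrightarrow> T \<in> measurable M M \<and> distr M M T = M"

definition invertible_mpt :: "'a measure \<Rightarrow> ('a \<Rightarrow> 'a) \<Rightarrow> bool" where
  "invertible_mpt M T \<longleftrightarrow> bij T \<and> inv T \<in> measurable M M \<and> measure_preserving M T"

definition ergodic :: "'a measure \<Rightarrow> ('a \<Rightarrow> 'a) \<Rightarrow> bool" where
  "ergodic M T \<longleftrightarrow> measure_preserving M T \<and>
     (\<forall>A\<in>sets M. T -` A \<inter> space M = A \<longrightarrow> measure M A = 0 \<or> measure M A = 1)"

definition weakly_mixing :: "'a measure \<Rightarrow> ('a \<Rightarrow> 'a) \<Rightarrow> bool" where
  "weakly_mixing M T \<longleftrightarrow> measure_preserving M T \<and>
     (\<forall>A\<in>sets M. \<forall>B\<in>sets M.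
        (\<lambda>N. (\<Sum>n<N. \<bar>measure M (A \<inter> ((T ^^ n) -` B \<inter> space M)) - measure M A * measure M B\<bar>) / real N)
          \<longlonglongrightarrow> 0)"

text \<open>Functions are not identified modulo null sets here.\<close>

definition L_infinity :: "'a measure \<Rightarrow> ('a \<Rightarrow> complex) set" where
  "L_infinity M = {f \<in> borel_measurable M. \<exists>C. AE x in M. norm (f x) \<le> C}"

end

theory Submission
  imports Defs
begin

text \<open>Along a family of commuting maps with ergodic Cartesian squares of all \<open>T i\<close> and
  \<open>T i \<circ> inv (T j)\<close>, van der Corput's lemma reduces mean convergence of the averages to the
  smaller family \<open>T i \<circ> inv (T j)\<close>, \<open>i \<noteq> j\<close> (Berend and Bergelson). Ergodicity of the Cartesian
  squares comes for free: an ergodic map commuting with a weakly mixing one is itself weakly mixing.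
  A diagonal argument then gives one sequence \<open>N\<close> along which the averages of all tuples of
  indicators of sets from a countable dense family converge almost everywhere. Replacing one
  function by another changes the averages by at most a constant times a Birkhoff average of the
  absolute difference, so the pointwise ergodic theorem carries convergence along the same \<open>N\<close> over
  to all bounded functions. Sums over \<open>n = 1..N\<close> are handled by replacing \<open>f i\<close> with
  \<open>f i \<circ> T i\<close>.\<close>

subsection \<open>The maximal and pointwise ergodic theorems\<close>

text \<open>Mean convergence yields almost everywhere convergence only along a subsequence that
  depends on the functions, while \<open>N\<close> must serve all of them. Hence \<open>N\<close> is
  fixed once, for countably many tuples, and no later step may extract again. Bounded functions on a
  nonatomic space have no countable uniformly dense set, so the approximation is in
  \<open>L\<^sup>1\<close>, and its error is controlled by a limit along all integers, which any
  \<open>N\<close> inherits. The induction on the number of maps closes because quotients of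
  quotients are quotients: the middle map cancels in \<open>(T i \<circ> inv (T j)) \<circ> inv (T l
  \<circ> inv (T j)) = T i \<circ> inv (T l)\<close>. Cartesian squares enter because the
  correlations of several functions get multiplied, so that one of them must be small in absolute
  value on average and signed cancellation is not enough. The square of a correlation is an integral
  over the product space, where ergodicity applies.\<close>

lemma measure_preservingD:
  assumes "measure_preserving M T"
  shows "T \<in> measurable M M" "distr M M T = M"
  using assms by (auto simp: measure_preserving_def)

lemma measure_preserving_integral:
  fixes f :: "'a \<Rightarrow> 'b::{banach, second_countable_topology}"
  assumes "measure_preserving M T" "f \<in> borel_measurable M"
  shows "(\<integral>x. f (T x) \<partial>M) = integral\<^sup>L M f"
  using integral_distr[of T M M f] measure_preservingD[OF assms(1)] assms(2) by simp

lemma measure_preserving_integrable: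
  fixes f :: "'a \<Rightarrow> 'b::{banach, second_countable_topology}"
  assumes "measure_preserving M T" "integrable M f"
  shows "integrable M (\<lambda>x. f (T x))"
  using integrable_distr[of T M M f] measure_preservingD[OF assms(1)] assms(2) by simp

lemma measure_preserving_AE:
  assumes "measure_preserving M T" "AE x in M. P x"
  shows "AE x in M. P (T x)"
proof -
  have "AE x in distr M M T. P x"
    unfolding measure_preservingD(2)[OF assms(1)] by fact
  then show ?thesis
    using AE_distrD measure_preservingD(1)[OF assms(1)] by blast
qed

lemma measure_preserving_comp:
  assumes "measure_preserving M S" "measure_preserving M T"
  shows "measure_preserving M (S \<circ> T)"
  using distr_distr[of S M M T M] assms by (auto simp: measure_preserving_def)

lemma measure_preserving_funpow:
  assumes "measure_preserving M T"
  shows "measure_preserving M (T ^^ n)"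
proof (induction n)
  case 0
  then show ?case by (simp add: measure_preserving_def id_def distr_id)
next
  case (Suc n)
  then show ?case using measure_preserving_comp[OF assms Suc] by (simp only: funpow.simps)
qed

lemma measure_preserving_funpow_measurable [measurable (raw)]:
  assumes "measure_preserving M T"
  shows "T ^^ n \<in> measurable M M"
  using measure_preservingD(1)[OF measure_preserving_funpow[OF assms]] .

lemma measure_preserving_inv:
  assumes "invertible_mpt M T"
  shows "measure_preserving M (inv T)"
proof -
  have T: "bij T" "inv T \<in> measurable M M" "T \<in> measurable M M" "distr M M T = M"
    using assms by (auto simp: invertible_mpt_def measure_preserving_def)
  have "distr M M (inv T) = distr (distr M M T) M (inv T)"
    using T by simp
  also have "\<dots> = distr M M (inv T \<circ> T)"
    using T by (intro distr_distr)
  also have "\<dots> = M"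
    using T by (simp add: bij_is_inj id_def distr_id)
  finally show ?thesis
    using T by (simp add: measure_preserving_def)
qed

text \<open>On an invariant set every term of the Cesaro mean is the same number
  \<open>\<bar>measure M A - measure M A * measure M A\<bar>\<close>, which must therefore
  vanish.\<close>

lemma weakly_mixing_ergodic:
  assumes "prob_space M" "weakly_mixing M T"
  shows "ergodic M T"
  unfolding ergodic_def
proof (intro conjI ballI impI)
  interpret prob_space M by fact
  show mp: "measure_preserving M T"
    using assms by (simp add: weakly_mixing_def)
  fix A assume A: "A \<in> sets M" "T -` A \<inter> space M = A"
  have inv: "(T ^^ n) -` A \<inter> space M = A" for n
  proof (induction n)
    case 0
    then show ?case using sets.sets_into_space[OF A(1)] by auto
  next
    case (Suc n)
    have "(T ^^ Suc n) -` A \<inter> space M = (T ^^ n) -` (T -` A \<inter> space M) \<inter> space M"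
      using measurable_space[OF measure_preserving_funpow_measurable[OF mp, of n]] by auto
    also have "\<dots> = A" using Suc A by simp
    finally show ?case .
  qed
  define d where "d = \<bar>measure M A - measure M A * measure M A\<bar>"
  have "(\<lambda>N. (\<Sum>n<N. \<bar>measure M (A \<inter> ((T ^^ n) -` A \<inter> space M)) - measure M A * measure M A\<bar>) / real N)
          \<longlonglongrightarrow> 0"
    using assms A by (simp add: weakly_mixing_def)
  then have "(\<lambda>N. (\<Sum>n<N. d) / real N) \<longlonglongrightarrow> 0"
    unfolding inv d_def by simp
  \<comment> \<open>At \<open>N = 0\<close> the quotient is \<open>0\<close> by the convention for
    division, so the sequence is constant only from \<open>1\<close> on.\<close>
  moreover have "(\<lambda>N. (\<Sum>n<N. d) / real N) \<longlonglongrightarrow> d"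
    by (rule tendsto_eventually, rule eventually_sequentiallyI[of 1]) auto
  ultimately have "d = 0" using LIMSEQ_unique by blast
  then have "measure M A * (1 - measure M A) = 0"
    by (simp add: d_def algebra_simps)
  then show "measure M A = 0 \<or> measure M A = 1" by simp
qed

section \<open>Birkhoff sums and Garsia's maximal inequality\<close>

definition birkhoff :: "('a \<Rightarrow> 'a) \<Rightarrow> ('a \<Rightarrow> real) \<Rightarrow> nat \<Rightarrow> 'a \<Rightarrow> real" where
  "birkhoff T f n x = (\<Sum>i<n. f ((T ^^ i) x))"

lemma birkhoff_Suc: "birkhoff T f (Suc n) x = f x + birkhoff T f n (T x)"
  unfolding birkhoff_def by (subst sum.lessThan_Suc_shift) (simp add: funpow_swap1)

lemma birkhoff_measurable:
  assumes "measure_preserving M T" and [measurable]: "f \<in> borel_measurable M"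
  shows "birkhoff T f n \<in> borel_measurable M"
proof -
  have [measurable]: "T ^^ i \<in> measurable M M" for i
    using measure_preserving_funpow_measurable[OF assms(1)] .
  show ?thesis unfolding birkhoff_def[abs_def] by measurable
qed

text \<open>\<open>garsia T f n\<close> is the maximum of the Birkhoff sums of length at most \<open>n\<close>, including the empty sum.\<close>

primrec garsia :: "('a \<Rightarrow> 'a) \<Rightarrow> ('a \<Rightarrow> real) \<Rightarrow> nat \<Rightarrow> 'a \<Rightarrow> real" where
  "garsia T f 0 x = 0"
| "garsia T f (Suc n) x = max 0 (f x + garsia T f n (T x))"

lemma garsia_nonneg: "garsia T f n x \<ge> 0"
  by (cases n) auto

lemma garsia_mono: "garsia T f n x \<le> garsia T f (Suc n) x"
proof (induction n arbitrary: x)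
  case (Suc n)
  then show ?case by (simp only: garsia.simps(2)) (meson Suc add_left_mono max.mono order_refl)
qed simp

lemma birkhoff_le_garsia: "birkhoff T f n x \<le> garsia T f n x"
proof (induction n arbitrary: x)
  case 0
  then show ?case by (simp add: birkhoff_def)
next
  case (Suc n)
  show ?case using Suc[of "T x"] by (simp add: birkhoff_Suc)
qed

text \<open>Garsia's argument. Where \<open>garsia T f n\<close> is positive, \<open>f x\<close>
  equals its value at \<open>x\<close> minus an earlier maximum at \<open>T x\<close>, hence is at
  least \<open>garsia T f n x - garsia T f n (T x)\<close>; elsewhere this difference is at most
  \<open>0\<close>. The difference has integral \<open>0\<close>, and the sets of positivity exhaust
  the space up to a null set.\<close>

lemma maximal_ergodic:
  assumes mp: "measure_preserving M T" and f: "integrable M f"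
    and pos: "AE x in M. \<exists>n. birkhoff T f n x > 0"
  shows "integral\<^sup>L M f \<ge> 0"
proof -
  let ?G = "garsia T f"
  have [measurable]: "T \<in> measurable M M" "f \<in> borel_measurable M"
    using measure_preservingD[OF mp] f by auto
  have G: "integrable M (?G n)" for n
  proof (induction n)
    case 0
    then show ?case by simp
  next
    case (Suc n)
    have "integrable M (\<lambda>x. max 0 (f x + ?G n (T x)))"
      using measure_preserving_integrable[OF mp Suc] f by (intro integrable_max) auto
    then show ?case by simp
  qed
  have [measurable]: "?G n \<in> borel_measurable M" for n
    using G by auto
  have fin: "(\<integral>x. (if ?G n x > 0 then f x else 0) \<partial>M) \<ge> 0" for n
  proof (cases n)
    case (Suc m)
    have "0 = (\<integral>x. ?G n x - ?G n (T x) \<partial>M)"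
      using measure_preserving_integral[OF mp, of "?G n"] measure_preserving_integrable[OF mp G, of n] G[of n]
      by simp
    also have "\<dots> \<le> (\<integral>x. (if ?G n x > 0 then f x else 0) \<partial>M)"
    proof (rule integral_mono)
      show "integrable M (\<lambda>x. ?G n x - ?G n (T x))"
        using measure_preserving_integrable[OF mp G, of n] G[of n] by simp
      show "integrable M (\<lambda>x. if ?G n x > 0 then f x else 0)"
        by (rule Bochner_Integration.integrable_bound[OF f]) auto
      fix x
      show "?G n x - ?G n (T x) \<le> (if ?G n x > 0 then f x else 0)"
        using garsia_nonneg[of T f n x] garsia_nonneg[of T f n "T x"] garsia_mono[of T f m "T x"] Suc
        by auto
    qed
    finally show ?thesis .
  qed simp
  have "(\<lambda>n. \<integral>x. (if ?G n x > 0 then f x else 0) \<partial>M) \<longlonglongrightarrow> integral\<^sup>L M f"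
  proof (rule integral_dominated_convergence[where w = "\<lambda>x. norm (f x)"])
    show "AE x in M. (\<lambda>n. if ?G n x > 0 then f x else 0) \<longlonglongrightarrow> f x"
      using pos
    proof eventually_elim
      case (elim x)
      then obtain m where "birkhoff T f m x > 0" by auto
      then have m: "?G m x > 0" using birkhoff_le_garsia[of T f m x] by linarith
      have "?G n x > 0" if "n \<ge> m" for n
        using lift_Suc_mono_le[of "\<lambda>n. ?G n x", OF garsia_mono that] m by linarith
      then show ?case
        by (intro tendsto_eventually eventually_sequentiallyI[of m]) auto
    qed
  qed (use f in auto)
  then show ?thesis
    by (rule LIMSEQ_le_const) (use fin in auto)
qed

text \<open>After subtraction of the mean and \<open>e\<close>, the claim is that the Birkhoff sums
  are eventually nonpositive. By ergodicity they tend to \<open>-\<infinity>\<close> either almost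
  everywhere, which is more than enough, or almost nowhere, which contradicts the maximal
  inequality.\<close>

lemma birkhoff_upper:
  assumes "prob_space M" and erg: "ergodic M T" and f: "integrable M f" and e: "e > 0"
  shows "AE x in M. eventually (\<lambda>n. birkhoff T f n x \<le> real n * (integral\<^sup>L M f + e)) sequentially"
proof -
  interpret prob_space M by fact
  have mp: "measure_preserving M T" using erg by (simp add: ergodic_def)
  note [measurable] = measure_preservingD(1)[OF mp]
  have [measurable]: "f \<in> borel_measurable M" using f by auto
  define g where "g x = f x - integral\<^sup>L M f - e" for x
  have g: "integrable M g" unfolding g_def[abs_def] using f by simp
  then have [measurable]: "g \<in> borel_measurable M" by auto
  note [measurable] = birkhoff_measurable[OF mp \<open>g \<in> borel_measurable M\<close>]
  have bg: "birkhoff T g n x = birkhoff T f n x - real n * (integral\<^sup>L M f + e)" for n x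
    by (simp add: birkhoff_def g_def sum_subtractf algebra_simps)
  \<comment> \<open>Divergence of the Birkhoff sums to \<open>-\<infinity>\<close> is an exactly invariant event.\<close>
  define B where "B = {x\<in>space M. \<forall>K::nat. \<exists>m. \<forall>n\<ge>m. birkhoff T g n x \<le> - real K}"
  have B[measurable]: "B \<in> sets M" unfolding B_def by measurable
  have shift: "(\<forall>K::nat. \<exists>m. \<forall>n\<ge>m. birkhoff T g n (T x) \<le> - real K) \<longleftrightarrow>
    (\<forall>K::nat. \<exists>m. \<forall>n\<ge>m. birkhoff T g n x \<le> - real K)" (is "?L \<longleftrightarrow> ?R") for x
  proof -
    \<comment> \<open>The sums along \<open>x\<close> and \<open>T x\<close> differ by the single
      term \<open>g x\<close>, so moving the level \<open>K\<close> by a bound of that term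
      suffices.\<close>
    obtain c :: nat where c: "\<bar>g x\<bar> \<le> real c" using real_arch_simple by blast
    show ?thesis
    proof
      assume L: ?L
      show ?R
      proof
        fix K :: nat
        obtain m where m: "\<forall>n\<ge>m. birkhoff T g n (T x) \<le> - real (K + c)"
          using L by blast
        have "birkhoff T g n x \<le> - real K" if "n \<ge> Suc m" for n
          using that m c by (cases n) (auto simp: birkhoff_Suc dest!: spec[of _ "n - 1"])
        then show "\<exists>m. \<forall>n\<ge>m. birkhoff T g n x \<le> - real K" by blast
      qed
    next
      assume R: ?R
      show ?L
      proof
        fix K :: nat
        obtain m where m: "\<forall>n\<ge>m. birkhoff T g n x \<le> - real (K + c)"
          using R by blast
        have "birkhoff T g n (T x) \<le> - real K" if "n \<ge> m" for n
          using m[rule_format, of "Suc n"] that c by (auto simp: birkhoff_Suc)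
        then show "\<exists>m. \<forall>n\<ge>m. birkhoff T g n (T x) \<le> - real K" by blast
      qed
    qed
  qed
  have "T -` B \<inter> space M = B"
    using shift measurable_space[OF measure_preservingD(1)[OF mp]] by (auto simp: B_def)
  then have "prob B = 0 \<or> prob B = 1"
    using erg B by (simp add: ergodic_def)
  then show ?thesis
  proof
    assume "prob B = 1"
    then have "AE x in M. x \<in> B" using prob_eq_1[OF B] by simp
    then show ?thesis
    proof eventually_elim
      case (elim x)
      then obtain m where "\<forall>n\<ge>m. birkhoff T g n x \<le> - real 0" unfolding B_def by blast
      then show ?case unfolding bg by (intro eventually_sequentiallyI[of m]) auto
    qed
  next
    assume "prob B = 0"
    then have notB: "AE x in M. x \<notin> B" using prob_eq_0[OF B] by simp
    \<comment> \<open>Half of the margin \<open>e\<close> is given back: the gain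
      \<open>real n * e / 2\<close> eventually exceeds any fixed \<open>K\<close>, while the
      integral stays at \<open>- e / 2 < 0\<close>.\<close>
    define g' where "g' x = g x + e / 2" for x
    have g': "integrable M g'" unfolding g'_def[abs_def] using g by simp
    have bg': "birkhoff T g' n x = birkhoff T g n x + real n * e / 2" for n x
      by (simp add: birkhoff_def g'_def sum.distrib)
    have "integral\<^sup>L M g' \<ge> 0"
    proof (rule maximal_ergodic[OF mp g'])
      show "AE x in M. \<exists>n. birkhoff T g' n x > 0"
        using notB AE_space
      proof eventually_elim
        case (elim x)
        then obtain K :: nat where K: "\<And>m. \<exists>n\<ge>m. birkhoff T g n x > - real K"
          unfolding B_def by (auto simp: not_le)
        obtain m :: nat where m: "2 * real K / e \<le> real m" using real_arch_simple by blast
        obtain n where n: "n \<ge> m" "birkhoff T g n x > - real K" using K by blast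
        have "2 * real K / e \<le> real n" using m n(1) by (meson of_nat_le_iff order_trans)
        then have "real K \<le> real n * e / 2" using e by (simp add: field_simps)
        then show ?case using n by (intro exI[of _ n]) (simp add: bg')
      qed
    qed
    moreover have "integral\<^sup>L M g' = - e / 2"
      unfolding g'_def g_def using f by (simp add: prob_space)
    ultimately show ?thesis using e by simp
  qed
qed

text \<open>The one-sided bound is applied to \<open>f\<close> and to its negative, with margins
  \<open>1 / real (Suc k)\<close> so that the exceptional sets form a countable union.\<close>

theorem birkhoff_ergodic:
  assumes "prob_space M" and erg: "ergodic M T" and f: "integrable M (f :: 'a \<Rightarrow> real)"
  shows "AE x in M. (\<lambda>n. (\<Sum>i<n. f ((T ^^ i) x)) / real n) \<longlonglongrightarrow> integral\<^sup>L M f"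
proof -
  have up: "AE x in M. \<forall>k. eventually (\<lambda>n. birkhoff T f n x \<le> real n * (integral\<^sup>L M f + 1 / real (Suc k))) sequentially"
    using birkhoff_upper[OF assms] by (simp add: AE_all_countable)
  have "integrable M (\<lambda>x. - f x)" using f by simp
  then have "AE x in M. \<forall>k. eventually (\<lambda>n. birkhoff T (\<lambda>x. - f x) n x \<le> real n * ((\<integral>x. - f x \<partial>M) + 1 / real (Suc k))) sequentially"
    using birkhoff_upper[OF assms(1,2), of "\<lambda>x. - f x"] by (simp add: AE_all_countable)
  then have lo: "AE x in M. \<forall>k. eventually (\<lambda>n. birkhoff T f n x \<ge> real n * (integral\<^sup>L M f - 1 / real (Suc k))) sequentially"
    by (simp add: birkhoff_def sum_negf algebra_simps)
  show ?thesis
    using up lo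
  proof eventually_elim
    case (elim x)
    show ?case
    proof (rule LIMSEQ_I)
      fix r :: real assume "r > 0"
      then obtain k where k: "1 / real (Suc k) < r"
        using nat_approx_posE by blast
      have "eventually (\<lambda>n. \<bar>birkhoff T f n x - real n * integral\<^sup>L M f\<bar> \<le> real n / real (Suc k) \<and> n \<ge> 1) sequentially"
        using elim(1)[rule_format, of k] elim(2)[rule_format, of k] eventually_ge_at_top[of 1]
      proof eventually_elim
        case (elim n)
        define a b where "a = real n * integral\<^sup>L M f" and "b = real n / real (Suc k)"
        have "birkhoff T f n x \<le> a + b" "a - b \<le> birkhoff T f n x"
          using elim(1,2)
          unfolding a_def b_def distrib_left right_diff_distrib times_divide_eq_right mult_1_right .
        then have "\<bar>birkhoff T f n x - a\<bar> \<le> b" by linarith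
        then show ?case using elim(3) unfolding a_def b_def by blast
      qed
      then obtain m where m: "\<And>n. n \<ge> m \<Longrightarrow> \<bar>birkhoff T f n x - real n * integral\<^sup>L M f\<bar> \<le> real n / real (Suc k) \<and> n \<ge> 1"
        unfolding eventually_sequentially by blast
      have "norm ((\<Sum>i<n. f ((T ^^ i) x)) / real n - integral\<^sup>L M f) < r" if "n \<ge> m" for n
      proof -
        have n: "real n > 0" using m[OF that] by simp
        have "\<bar>birkhoff T f n x / real n - integral\<^sup>L M f\<bar> = \<bar>birkhoff T f n x - real n * integral\<^sup>L M f\<bar> / real n"
        proof -
          have "birkhoff T f n x / real n - integral\<^sup>L M f = (birkhoff T f n x - real n * integral\<^sup>L M f) / real n"
            using n by (simp add: diff_divide_distrib)
          then show ?thesis by simp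
        qed
        also have "\<dots> \<le> 1 / real (Suc k)"
          using divide_right_mono[OF conjunct1[OF m[OF that]], of "real n"] n by simp
        finally show ?thesis using k by (simp add: birkhoff_def)
      qed
      then show "\<exists>no. \<forall>n\<ge>no. norm ((\<Sum>i<n. f ((T ^^ i) x)) / real n - integral\<^sup>L M f) < r"
        by blast
    qed
  qed
qed

text \<open>Along an orbit an invariant function is constant, so its Birkhoff averages are its value
  at \<open>x\<close>; the pointwise theorem identifies this with the integral, without a detour
  through level sets.\<close>

lemma ergodic_invariant_const:
  assumes "prob_space M" and erg: "ergodic M T" and f: "integrable M (f :: 'a \<Rightarrow> real)"
    and inv: "\<And>x. x \<in> space M \<Longrightarrow> f (T x) = f x"
  shows "AE x in M. f x = integral\<^sup>L M f"
proof -
  have mp: "measure_preserving M T" using erg by (simp add: ergodic_def)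
  show ?thesis
    using birkhoff_ergodic[OF assms(1-3)] AE_space
  proof eventually_elim
    case (elim x)
    have "(T ^^ i) x \<in> space M" for i
      using measurable_space[OF measure_preserving_funpow_measurable[OF mp]] elim(2) by blast
    then have "f ((T ^^ i) x) = f x" for i
      by (induction i) (auto simp: inv)
    then have "(\<lambda>n. (\<Sum>i<n. f x) / real n) \<longlonglongrightarrow> integral\<^sup>L M f"
      using elim(1) by simp
    moreover have "(\<lambda>n. (\<Sum>i<n. f x) / real n) \<longlonglongrightarrow> f x"
      by (rule tendsto_eventually, rule eventually_sequentiallyI[of 1]) auto
    ultimately show ?case using LIMSEQ_unique by blast
  qed
qed

subsection \<open>Ergodicity of Cartesian squares\<close>

lemma (in prob_space) integrable_bounded:
  fixes f :: "'a \<Rightarrow> real"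
  assumes "f \<in> borel_measurable M" "\<And>x. x \<in> space M \<Longrightarrow> \<bar>f x\<bar> \<le> C"
  shows "integrable M f"
  by (rule integrable_const_bound[where B = C]) (use assms in auto)

lemma (in prob_space) abs_integral_le:
  fixes f :: "'a \<Rightarrow> real"
  assumes [measurable]: "f \<in> borel_measurable M" and b: "\<And>x. x \<in> space M \<Longrightarrow> \<bar>f x\<bar> \<le> C"
  shows "\<bar>\<integral>x. f x \<partial>M\<bar> \<le> C"
proof -
  have "\<bar>\<integral>x. f x \<partial>M\<bar> \<le> (\<integral>x. \<bar>f x\<bar> \<partial>M)" by (rule integral_abs_bound)
  also have "\<dots> \<le> (\<integral>x. C \<partial>M)"
    by (rule integral_mono) (use b in \<open>auto intro!: integrable_bounded[where C = C]\<close>)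
  finally show ?thesis by (simp add: prob_space)
qed

text \<open>Separability of the measure algebra. The integral is the measure of the symmetric
  difference, written as an \<open>L\<^sup>1\<close> distance because the later estimates are in
  that norm.\<close>

definition countably_dense :: "'a measure \<Rightarrow> 'a set set \<Rightarrow> bool" where
  "countably_dense M \<A> \<longleftrightarrow> countable \<A> \<and> \<A> \<subseteq> sets M \<and>
     (\<forall>B\<in>sets M. \<forall>e>0. \<exists>U\<in>\<A>. (\<integral>x. \<bar>indicator B x - indicator U x\<bar> \<partial>M) < (e::real))"

lemma measure_preserving_map_prod:
  assumes "prob_space M" "measure_preserving M R"
  shows "measure_preserving (M \<Otimes>\<^sub>M M) (map_prod R R)"
proof -
  interpret prob_space M by fact
  have [measurable]: "R \<in> measurable M M" and d: "distr M M R = M"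
    using measure_preservingD[OF assms(2)] by auto
  have "sigma_finite_measure (distr M M R)"
    unfolding d by (rule sigma_finite_measure_axioms)
  then have "distr M M R \<Otimes>\<^sub>M distr M M R = distr (M \<Otimes>\<^sub>M M) (M \<Otimes>\<^sub>M M) (\<lambda>(x, y). (R x, R y))"
    by (intro pair_measure_distr) auto
  then show ?thesis
    by (simp add: measure_preserving_def d map_prod_def)
qed

text \<open>Let \<open>E\<close> be invariant with sections \<open>E\<^sub>x\<close>. By ergodicity of \<open>R\<close>, the measures of \<open>E\<^sub>x\<close> and of
  \<open>E\<^sub>x \<inter> E\<^sub>y\<close> with \<open>y = T\<^sup>m x\<close> are almost everywhere constants \<open>p\<close> and \<open>c m\<close>. Weak mixing of \<open>T\<close> gives
  \<open>c m \<approx> p\<^sup>2\<close> for most \<open>m\<close>. By separability the sections over some set \<open>G\<close> of positive measure are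
  \<open>\<epsilon>\<close>-close to each other, and for most \<open>m\<close> some \<open>x\<close> and \<open>T\<^sup>m x\<close> both lie in \<open>G\<close>, so \<open>c m \<ge> p - \<epsilon>\<close>.
  Hence \<open>p = p\<^sup>2\<close>.\<close>

lemma ergodic_map_prod_self:
  assumes "prob_space M" and dense: "countably_dense M \<A>"
    and erg: "ergodic M R" and wm: "weakly_mixing M T" and comm: "R \<circ> T = T \<circ> R"
  shows "ergodic (M \<Otimes>\<^sub>M M) (map_prod R R)"
  unfolding ergodic_def
proof (intro conjI ballI impI)
  interpret prob_space M by fact
  interpret P: pair_prob_space M M ..
  have mpR: "measure_preserving M R" and mpT: "measure_preserving M T"
    using erg wm by (auto simp: ergodic_def weakly_mixing_def)
  show "measure_preserving (M \<Otimes>\<^sub>M M) (map_prod R R)"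
    using measure_preserving_map_prod[OF assms(1) mpR] .
  note [measurable] = measure_preservingD(1)[OF mpR] measure_preservingD(1)[OF mpT]
  have [measurable]: "T ^^ m \<in> measurable M M" for m
    using measure_preserving_funpow_measurable[OF mpT] .
  have comm_m: "(T ^^ m) (R x) = R ((T ^^ m) x)" for m x
    by (induction m) (use fun_cong[OF comm] in auto)
  fix E assume E[measurable]: "E \<in> sets (M \<Otimes>\<^sub>M M)"
    and inv: "map_prod R R -` E \<inter> space (M \<Otimes>\<^sub>M M) = E"
  have Rsp: "R x \<in> space M" if "x \<in> space M" for x
    using that measurable_space[OF measure_preservingD(1)[OF mpR]] by auto
  have Tsp: "(T ^^ m) x \<in> space M" if "x \<in> space M" for x m
    using that measurable_space[OF measure_preserving_funpow_measurable[OF mpT]] by auto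
  define e where "e x y = (indicator E (x, y) :: real)" for x y
  have e_m[measurable]: "(\<lambda>z. e (f z) (g z)) \<in> borel_measurable N"
    if "f \<in> measurable N M" "g \<in> measurable N M" for f g and N :: "'c measure"
    using that unfolding e_def by measurable
  have e_R: "e (R x) (R y) = e x y" if "x \<in> space M" "y \<in> space M" for x y
  proof -
    have "(x, y) \<in> E \<longleftrightarrow> (R x, R y) \<in> E"
      using that by (subst inv[symmetric]) (auto simp: space_pair_measure)
    then show ?thesis by (simp add: e_def indicator_def)
  qed
  have e_bd: "0 \<le> e x y" "e x y \<le> 1" "\<bar>e x y\<bar> = e x y" "e x y * e x y = e x y" for x y
    by (auto simp: e_def indicator_def)
  define p where "p = (\<integral>x. (\<integral>y. e x y \<partial>M) \<partial>M)"
  have intE: "integrable (M \<Otimes>\<^sub>M M) (case_prod e)"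
    by (rule P.integrable_bounded[where C = 1]) (auto simp: e_bd split_beta')
  have p_meas: "p = measure (M \<Otimes>\<^sub>M M) E"
  proof -
    have "p = (\<integral>z. e (fst z) (snd z) \<partial>(M \<Otimes>\<^sub>M M))"
      unfolding p_def using P.integral_fst[OF intE] by (simp add: split_beta')
    also have "\<dots> = measure (M \<Otimes>\<^sub>M M) E"
      unfolding e_def using sets.sets_into_space[OF E] by (simp add: Int_absorb2)
    finally show ?thesis .
  qed
  have p_fub: "p = (\<integral>y. (\<integral>x. e x y \<partial>M) \<partial>M)"
    unfolding p_def using P.Fubini_integral[OF intE] by simp
  have row: "AE x in M. (\<integral>y. e x y \<partial>M) = p"
    unfolding p_def
  proof (rule ergodic_invariant_const[OF assms(1) erg])
    show "integrable M (\<lambda>x. \<integral>y. e x y \<partial>M)"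
      by (intro integrable_bounded[where C = 1] abs_integral_le) (auto simp: e_bd)
    fix x assume "x \<in> space M"
    then show "(\<integral>y. e (R x) y \<partial>M) = (\<integral>y. e x y \<partial>M)"
      using measure_preserving_integral[OF mpR, of "e (R x)"] Rsp
      by (simp add: e_R cong: Bochner_Integration.integral_cong)
  qed
  have col: "AE y in M. (\<integral>x. e x y \<partial>M) = p"
    unfolding p_fub
  proof (rule ergodic_invariant_const[OF assms(1) erg])
    show "integrable M (\<lambda>y. \<integral>x. e x y \<partial>M)"
      by (intro integrable_bounded[where C = 1] abs_integral_le) (auto simp: e_bd)
    fix y assume "y \<in> space M"
    then show "(\<integral>x. e x (R y) \<partial>M) = (\<integral>x. e x y \<partial>M)"
      using measure_preserving_integral[OF mpR, of "\<lambda>x. e x (R y)"] Rsp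
      by (simp add: e_R cong: Bochner_Integration.integral_cong)
  qed
  have ee_bd: "\<bar>e x y * e x' y'\<bar> \<le> 1" for x y x' y'
    using e_bd by (auto simp: abs_mult intro: mult_le_one)
  define c where "c m = (\<integral>x. (\<integral>y. e x y * e ((T ^^ m) x) y \<partial>M) \<partial>M)" for m
  have row_m: "AE x in M. (\<integral>y. e x y * e ((T ^^ m) x) y \<partial>M) = c m" for m
    unfolding c_def
  proof (rule ergodic_invariant_const[OF assms(1) erg])
    show "integrable M (\<lambda>x. \<integral>y. e x y * e ((T ^^ m) x) y \<partial>M)"
      by (intro integrable_bounded[where C = 1] abs_integral_le) (auto simp: ee_bd)
    fix x assume x: "x \<in> space M"
    have "(\<integral>y. e (R x) y * e ((T ^^ m) (R x)) y \<partial>M)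
        = (\<integral>y. e (R x) (R y) * e (R ((T ^^ m) x)) (R y) \<partial>M)"
      using measure_preserving_integral[OF mpR, of "\<lambda>y. e (R x) y * e ((T ^^ m) (R x)) y"] x Rsp Tsp
      by (simp add: comm_m)
    then show "(\<integral>y. e (R x) y * e ((T ^^ m) (R x)) y \<partial>M) = (\<integral>y. e x y * e ((T ^^ m) x) y \<partial>M)"
      using x Tsp by (simp add: e_R cong: Bochner_Integration.integral_cong)
  qed
  \<comment> \<open>In \<open>c m\<close> the point \<open>x\<close> is moved, where weak mixing
    says nothing directly. With the order of integration exchanged, a fixed \<open>y\<close> gives
    the column \<open>B\<close> of all \<open>x\<close> with \<open>(x, y) \<in> E\<close>, and the
    inner integral is the measure of \<open>B\<close> intersected with its preimage under
    \<open>T ^^ m\<close>.\<close>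
  define \<psi> where "\<psi> m y = (\<integral>x. e x y * e ((T ^^ m) x) y \<partial>M)" for m y
  have [measurable]: "\<psi> m \<in> borel_measurable M" for m
    unfolding \<psi>_def[abs_def] by measurable
  have \<psi>_bd: "\<bar>\<psi> m y\<bar> \<le> 1" if "y \<in> space M" for m y
    unfolding \<psi>_def by (intro abs_integral_le) (use that in \<open>auto simp: ee_bd\<close>)
  have c_fub: "c m = (\<integral>y. \<psi> m y \<partial>M)" for m
  proof -
    have "integrable (M \<Otimes>\<^sub>M M) (case_prod (\<lambda>x y. e x y * e ((T ^^ m) x) y))"
      by (rule P.integrable_bounded[where C = 1]) (auto simp: ee_bd split_beta')
    from P.Fubini_integral[OF this] show ?thesis by (simp add: c_def \<psi>_def)
  qed
  have p01: "0 \<le> p" "p \<le> 1" by (simp_all add: p_meas)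
  have p2: "0 \<le> p\<^sup>2" "p\<^sup>2 \<le> 1" using p01 by (auto simp: power_le_one)
  have avg_\<psi>: "AE y in M. (\<lambda>N. (\<Sum>m<N. \<bar>\<psi> m y - p\<^sup>2\<bar>) / real N) \<longlonglongrightarrow> 0"
    using col AE_space
  proof eventually_elim
    case (elim y)
    define B where "B = {x\<in>space M. (x, y) \<in> E}"
    have [measurable]: "B \<in> sets M" unfolding B_def using elim(2) by measurable
    have "p = measure M B"
    proof -
      have "p = (\<integral>x. indicator B x \<partial>M)" unfolding elim(1)[symmetric]
        by (rule Bochner_Integration.integral_cong) (auto simp: e_def B_def indicator_def)
      then show ?thesis using sets.sets_into_space[OF \<open>B \<in> sets M\<close>] by (simp add: Int_absorb2)
    qed
    moreover have "\<psi> m y = measure M (B \<inter> ((T ^^ m) -` B \<inter> space M))" for m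
    proof -
      have "\<psi> m y = (\<integral>x. indicator (B \<inter> ((T ^^ m) -` B \<inter> space M)) x \<partial>M)" unfolding \<psi>_def
        by (rule Bochner_Integration.integral_cong) (auto simp: e_def B_def indicator_def Tsp)
      then show ?thesis by (simp add: B_def Int_absorb2 subset_eq)
    qed
    ultimately show ?case
      using wm \<open>B \<in> sets M\<close> unfolding weakly_mixing_def by (simp add: power2_eq_square)
  qed
  have avg_c: "(\<lambda>N. (\<Sum>m<N. \<bar>c m - p\<^sup>2\<bar>) / real N) \<longlonglongrightarrow> 0"
  proof (rule tendsto_sandwich[OF always_eventually always_eventually tendsto_const])
    show "\<forall>N. 0 \<le> (\<Sum>m<N. \<bar>c m - p\<^sup>2\<bar>) / real N" by (auto intro!: sum_nonneg divide_nonneg_nonneg)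
    have i1: "integrable M (\<psi> m)" for m
      by (rule integrable_bounded[where C = 1]) (auto simp: \<psi>_bd)
    show "\<forall>N. (\<Sum>m<N. \<bar>c m - p\<^sup>2\<bar>) / real N \<le> (\<integral>y. (\<Sum>m<N. \<bar>\<psi> m y - p\<^sup>2\<bar>) / real N \<partial>M)"
    proof
      fix N
      have "\<bar>c m - p\<^sup>2\<bar> \<le> (\<integral>y. \<bar>\<psi> m y - p\<^sup>2\<bar> \<partial>M)" for m
      proof -
        have "c m - p\<^sup>2 = (\<integral>y. \<psi> m y - p\<^sup>2 \<partial>M)"
          using i1[of m] by (simp add: c_fub prob_space)
        then show ?thesis using integral_abs_bound[of M "\<lambda>y. \<psi> m y - p\<^sup>2"] by simp
      qed
      then have "(\<Sum>m<N. \<bar>c m - p\<^sup>2\<bar>) / real N \<le> (\<Sum>m<N. (\<integral>y. \<bar>\<psi> m y - p\<^sup>2\<bar> \<partial>M)) / real N"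
        by (intro divide_right_mono sum_mono) auto
      also have "\<dots> = (\<integral>y. (\<Sum>m<N. \<bar>\<psi> m y - p\<^sup>2\<bar>) / real N \<partial>M)"
        using i1 by simp
      finally show "(\<Sum>m<N. \<bar>c m - p\<^sup>2\<bar>) / real N \<le> (\<integral>y. (\<Sum>m<N. \<bar>\<psi> m y - p\<^sup>2\<bar>) / real N \<partial>M)" .
    qed
    have "(\<lambda>N. \<integral>y. (\<Sum>m<N. \<bar>\<psi> m y - p\<^sup>2\<bar>) / real N \<partial>M) \<longlonglongrightarrow> (\<integral>y. 0 \<partial>M)"
    proof (rule integral_dominated_convergence[where w = "\<lambda>_. 2"])
      fix N
      have "(\<Sum>m<N. \<bar>\<psi> m y - p\<^sup>2\<bar>) \<le> (\<Sum>m<N. 2)" if "y \<in> space M" for y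
      proof (rule sum_mono)
        fix m show "\<bar>\<psi> m y - p\<^sup>2\<bar> \<le> 2" using \<psi>_bd[of y m] that p2 by linarith
      qed
      then have "norm ((\<Sum>m<N. \<bar>\<psi> m y - p\<^sup>2\<bar>) / real N) \<le> 2" if "y \<in> space M" for y
        using that by (cases "N = 0") (auto simp: abs_of_nonneg sum_nonneg divide_simps mult.commute)
      then show "AE y in M. norm ((\<Sum>m<N. \<bar>\<psi> m y - p\<^sup>2\<bar>) / real N) \<le> 2" by simp
    qed (use avg_\<psi> in auto)
    then show "(\<lambda>N. \<integral>y. (\<Sum>m<N. \<bar>\<psi> m y - p\<^sup>2\<bar>) / real N \<partial>M) \<longlonglongrightarrow> 0" by simp
  qed
  have "p = 0 \<or> p = 1"
  proof (rule ccontr)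
    assume "\<not> ?thesis"
    then have "0 < p * (1 - p)" using p01 by (intro mult_pos_pos) auto
    \<comment> \<open>Half of the gap between \<open>p\<close> and \<open>p\<^sup>2\<close>: the
      lower bound \<open>p - \<epsilon>\<close> for \<open>c m\<close> still keeps it at distance
      \<open>\<epsilon>\<close> from \<open>p\<^sup>2\<close>.\<close>
    define \<epsilon> where "\<epsilon> = p * (1 - p) / 2"
    have \<epsilon>: "\<epsilon> > 0" "p - \<epsilon> = p\<^sup>2 + \<epsilon>"
      using \<open>0 < p * (1 - p)\<close> by (auto simp: \<epsilon>_def power2_eq_square field_simps)
    \<comment> \<open>Radius \<open>\<epsilon> / 2\<close> around a common \<open>U\<close>, so that
      two sections over \<open>G U\<close> are within \<open>\<epsilon>\<close> of each
      other.\<close>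
    define G where "G U = {x\<in>space M. (\<integral>y. \<bar>e x y - indicator U y\<bar> \<partial>M) < \<epsilon> / 2}" for U
    have A_sets: "U \<in> sets M" if "U \<in> \<A>" for U
      using that dense by (auto simp: countably_dense_def)
    have G_sets[measurable]: "G U \<in> sets M" if "U \<in> \<A>" for U
      using A_sets[OF that] unfolding G_def by measurable
    have cover: "\<exists>U\<in>\<A>. x \<in> G U" if "x \<in> space M" for x
    proof -
      have B: "{y\<in>space M. (x, y) \<in> E} \<in> sets M" using that by measurable
      have "\<epsilon> / 2 > 0" using \<epsilon>(1) by simp
      with B obtain U where U: "U \<in> \<A>"
        "(\<integral>y. \<bar>indicator {y\<in>space M. (x, y) \<in> E} y - indicator U y\<bar> \<partial>M) < \<epsilon> / 2"
        using dense unfolding countably_dense_def by blast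
      have "(\<integral>y. \<bar>e x y - indicator U y\<bar> \<partial>M) =
          (\<integral>y. \<bar>indicator {y\<in>space M. (x, y) \<in> E} y - indicator U y\<bar> \<partial>M)"
        by (rule Bochner_Integration.integral_cong) (auto simp: e_def indicator_def)
      then have "x \<in> G U" using U(2) that unfolding G_def by (simp only: mem_Collect_eq)
      then show ?thesis using U(1) by blast
    qed
    have "\<exists>U\<in>\<A>. prob (G U) \<noteq> 0"
    proof (rule ccontr)
      assume "\<not> ?thesis"
      then have "\<And>U. U \<in> \<A> \<Longrightarrow> AE x in M. x \<notin> G U"
        using prob_eq_0[OF G_sets] by auto
      then have "AE x in M. \<forall>U\<in>\<A>. x \<notin> G U"
        using dense by (subst AE_ball_countable) (auto simp: countably_dense_def)
      then have "AE x in M. False" using AE_space by eventually_elim (use cover in auto)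
      then show False using AE_False by (simp add: emeasure_space_1)
    qed
    then obtain U where U: "U \<in> \<A>" "prob (G U) > 0"
      using measure_nonneg by (metis less_eq_real_def)
    note [measurable] = A_sets[OF U(1)] G_sets[OF U(1)]
    define D where "D m = G U \<inter> ((T ^^ m) -` G U \<inter> space M)" for m
    have D_sets: "D m \<in> sets M" for m
      unfolding D_def by measurable
    have big: "c m \<ge> p - \<epsilon>" if "prob (D m) \<noteq> 0" for m
    proof -
      have "\<not> (AE x in M. x \<notin> D m)" using prob_eq_0[OF D_sets] that by auto
      then obtain x where x: "x \<in> D m" "(\<integral>y. e x y \<partial>M) = p"
        "(\<integral>y. e x y * e ((T ^^ m) x) y \<partial>M) = c m"
        using row row_m[of m] by (smt (verit) eventually_elim2)
      let ?x = "(T ^^ m) x"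
      have xs: "x \<in> space M" "?x \<in> space M" using x(1) Tsp by (auto simp: D_def G_def)
      have i0: "integrable M (e x)" if "x \<in> space M" for x
        using that by (intro integrable_bounded[where C = 1]) (auto simp: e_bd)
      have i1: "integrable M (\<lambda>y. e x y * e ?x y)"
        using xs by (intro integrable_bounded[where C = 1]) (auto simp: ee_bd)
      have i2: "integrable M (\<lambda>y. \<bar>e x y - indicator U y\<bar>)" if "x \<in> space M" for x
        using that by (intro integrable_bounded[where C = 1]) (auto simp: e_def indicator_def)
      have "p - c m = (\<integral>y. e x y - e x y * e ?x y \<partial>M)"
        using x i0[OF xs(1)] i1 by simp
      also have "\<dots> \<le> (\<integral>y. \<bar>e x y - indicator U y\<bar> + \<bar>e ?x y - indicator U y\<bar> \<partial>M)"
      proof (rule integral_mono)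
        show "integrable M (\<lambda>y. e x y - e x y * e ?x y)"
          using i0[OF xs(1)] i1 by (rule Bochner_Integration.integrable_diff)
        show "integrable M (\<lambda>y. \<bar>e x y - indicator U y\<bar> + \<bar>e ?x y - indicator U y\<bar>)"
          using i2[OF xs(1)] i2[OF xs(2)] by (rule Bochner_Integration.integrable_add)
      qed (auto simp: e_def indicator_def)
      also have "\<dots> = (\<integral>y. \<bar>e x y - indicator U y\<bar> \<partial>M) + (\<integral>y. \<bar>e ?x y - indicator U y\<bar> \<partial>M)"
        using i2 xs by simp
      also have "\<dots> < \<epsilon>" using x(1) by (simp add: D_def G_def)
      finally show ?thesis by linarith
    qed
    \<comment> \<open>For each \<open>m\<close>, either \<open>D m\<close> is null and its deviation
      equals \<open>(prob (G U))\<^sup>2\<close>, or \<open>c m\<close> is at least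
      \<open>\<epsilon>\<close> away from \<open>p\<^sup>2\<close>. So the two deviations never add
      up to less than \<open>d\<close>, although both means tend to \<open>0\<close>.\<close>
    define d where "d = min \<epsilon> ((prob (G U))\<^sup>2)"
    have d: "d > 0" using \<epsilon> U(2) by (simp add: d_def)
    have avg_D: "(\<lambda>N. (\<Sum>m<N. \<bar>prob (D m) - (prob (G U))\<^sup>2\<bar>) / real N) \<longlonglongrightarrow> 0"
      using wm G_sets[OF U(1)] unfolding weakly_mixing_def D_def by (simp add: power2_eq_square)
    have "(\<lambda>N. (\<Sum>m<N. \<bar>c m - p\<^sup>2\<bar>) / real N + (\<Sum>m<N. \<bar>prob (D m) - (prob (G U))\<^sup>2\<bar>) / real N) \<longlonglongrightarrow> 0"
      using tendsto_add[OF avg_c avg_D] by simp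
    moreover have "eventually (\<lambda>N. d \<le> (\<Sum>m<N. \<bar>c m - p\<^sup>2\<bar>) / real N
        + (\<Sum>m<N. \<bar>prob (D m) - (prob (G U))\<^sup>2\<bar>) / real N) sequentially"
    proof (rule eventually_sequentiallyI[of 1])
      fix N :: nat assume N: "1 \<le> N"
      have "d \<le> \<bar>c m - p\<^sup>2\<bar> + \<bar>prob (D m) - (prob (G U))\<^sup>2\<bar>" for m
      proof (cases "prob (D m) = 0")
        case True
        then show ?thesis by (simp add: d_def)
      next
        case False
        then show ?thesis using big[OF False] \<epsilon> unfolding d_def by linarith
      qed
      then have "(\<Sum>m<N. d) \<le> (\<Sum>m<N. \<bar>c m - p\<^sup>2\<bar> + \<bar>prob (D m) - (prob (G U))\<^sup>2\<bar>)"
        by (rule sum_mono)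
      then have "d * real N \<le> (\<Sum>m<N. \<bar>c m - p\<^sup>2\<bar>) + (\<Sum>m<N. \<bar>prob (D m) - (prob (G U))\<^sup>2\<bar>)"
        by (simp add: sum.distrib mult.commute)
      then show "d \<le> (\<Sum>m<N. \<bar>c m - p\<^sup>2\<bar>) / real N
        + (\<Sum>m<N. \<bar>prob (D m) - (prob (G U))\<^sup>2\<bar>) / real N"
        using N by (simp add: pos_le_divide_eq flip: add_divide_distrib)
    qed
    ultimately have "d \<le> 0" by (rule tendsto_lowerbound) simp
    then show False using d by simp
  qed
  then show "measure (M \<Otimes>\<^sub>M M) E = 0 \<or> measure (M \<Otimes>\<^sub>M M) E = 1"
    by (simp add: p_meas)
qed

subsection \<open>Autocorrelations and van der Corput's lemma\<close>

definition bounded_measurable :: "'a measure \<Rightarrow> ('a \<Rightarrow> 'b::real_normed_vector) \<Rightarrow> bool" where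
  "bounded_measurable M f \<longleftrightarrow> f \<in> borel_measurable M \<and> (\<exists>C. \<forall>x. norm (f x) \<le> C)"

lemma bounded_measurableI:
  "f \<in> borel_measurable M \<Longrightarrow> (\<And>x. norm (f x) \<le> C) \<Longrightarrow> bounded_measurable M f"
  by (auto simp: bounded_measurable_def)

lemma bounded_measurableD [measurable_dest]:
  "bounded_measurable M f \<Longrightarrow> f \<in> borel_measurable M"
  by (simp add: bounded_measurable_def)

lemma bounded_measurable_bound:
  assumes "bounded_measurable M f"
  obtains C where "C > 0" "\<And>x. norm (f x) \<le> C"
proof -
  obtain C where C: "\<And>x. norm (f x) \<le> C" using assms by (auto simp: bounded_measurable_def)
  show ?thesis
    by (rule that[of "max C 1"]) (use C in \<open>auto simp: le_max_iff_disj\<close>)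
qed

lemma bounded_measurable_const: "bounded_measurable M (\<lambda>_. c)"
  by (auto simp: bounded_measurable_def)

lemma bounded_measurable_comp:
  assumes "bounded_measurable M f" "T \<in> measurable N M"
  shows "bounded_measurable N (\<lambda>x. f (T x))"
  using assms by (auto simp: bounded_measurable_def)

lemma bounded_measurable_mult:
  fixes f g :: "'a \<Rightarrow> 'b::{real_normed_field, second_countable_topology}"
  assumes "bounded_measurable M f" "bounded_measurable M g"
  shows "bounded_measurable M (\<lambda>x. f x * g x)"
proof -
  obtain C D where "C > 0" "\<And>x. norm (f x) \<le> C" "\<And>x. norm (g x) \<le> D"
    using assms by (metis bounded_measurable_bound)
  then have "norm (f x * g x) \<le> C * D" for x
    unfolding norm_mult by (intro mult_mono) auto
  then show ?thesis
    using assms by (auto simp: bounded_measurable_def)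
qed

lemma bounded_measurable_add:
  fixes f g :: "'a \<Rightarrow> 'b::{real_normed_vector, second_countable_topology}"
  assumes "bounded_measurable M f" "bounded_measurable M g"
  shows "bounded_measurable M (\<lambda>x. f x + g x)"
proof -
  obtain C D where "\<And>x. norm (f x) \<le> C" "\<And>x. norm (g x) \<le> D"
    using assms by (metis bounded_measurable_bound)
  then have "norm (f x + g x) \<le> C + D" for x
    by (meson add_mono norm_triangle_ineq order_trans)
  then show ?thesis
    using assms by (auto simp: bounded_measurable_def)
qed

lemma bounded_measurable_uminus:
  fixes f :: "'a \<Rightarrow> 'b::{real_normed_vector, second_countable_topology}"
  shows "bounded_measurable M f \<Longrightarrow> bounded_measurable M (\<lambda>x. - f x)"
  by (auto simp: bounded_measurable_def)

lemma bounded_measurable_diff: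
  fixes f g :: "'a \<Rightarrow> 'b::{real_normed_vector, second_countable_topology}"
  assumes "bounded_measurable M f" "bounded_measurable M g"
  shows "bounded_measurable M (\<lambda>x. f x - g x)"
  using bounded_measurable_add[OF assms(1) bounded_measurable_uminus[OF assms(2)]] by simp

lemma bounded_measurable_prod:
  fixes f :: "'i \<Rightarrow> 'a \<Rightarrow> 'b::{real_normed_field, second_countable_topology}"
  assumes "\<And>i. i \<in> I \<Longrightarrow> bounded_measurable M (f i)"
  shows "bounded_measurable M (\<lambda>x. \<Prod>i\<in>I. f i x)"
  using assms
  by (induction I rule: infinite_finite_induct)
    (simp_all add: bounded_measurable_const bounded_measurable_add bounded_measurable_mult)

lemma bounded_measurable_sum:
  fixes f :: "'i \<Rightarrow> 'a \<Rightarrow> 'b::{real_normed_vector, second_countable_topology}"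
  assumes "\<And>i. i \<in> I \<Longrightarrow> bounded_measurable M (f i)"
  shows "bounded_measurable M (\<lambda>x. \<Sum>i\<in>I. f i x)"
  using assms
  by (induction I rule: infinite_finite_induct)
    (simp_all add: bounded_measurable_const bounded_measurable_add bounded_measurable_mult)

lemma bounded_measurable_divide:
  fixes f :: "'a \<Rightarrow> real"
  assumes "bounded_measurable M f"
  shows "bounded_measurable M (\<lambda>x. f x / c)"
  using bounded_measurable_mult[OF assms bounded_measurable_const[of M "1 / c"]] by simp

lemma bounded_measurable_power2:
  fixes f :: "'a \<Rightarrow> real"
  assumes "bounded_measurable M f"
  shows "bounded_measurable M (\<lambda>x. (f x)\<^sup>2)"
  using bounded_measurable_mult[OF assms assms] by (simp add: power2_eq_square)

lemma bounded_measurable_abs: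
  fixes f :: "'a \<Rightarrow> real"
  shows "bounded_measurable M f \<Longrightarrow> bounded_measurable M (\<lambda>x. \<bar>f x\<bar>)"
  by (auto simp: bounded_measurable_def)

lemmas bounded_measurable_intros =
  bounded_measurable_const bounded_measurable_add bounded_measurable_diff bounded_measurable_mult
  bounded_measurable_power2 bounded_measurable_divide bounded_measurable_sum bounded_measurable_prod
  bounded_measurable_abs

context prob_space
begin

lemma bounded_measurable_integrable:
  fixes f :: "'a \<Rightarrow> 'b::{banach, second_countable_topology}"
  assumes "bounded_measurable M f"
  shows "integrable M f"
  using assms integrable_const_bound[of f] by (auto simp: bounded_measurable_def)

lemma integral_power2_le:
  fixes f :: "'a \<Rightarrow> real"
  assumes "bounded_measurable M f"
  shows "(integral\<^sup>L M f)\<^sup>2 \<le> (\<integral>x. (f x)\<^sup>2 \<partial>M)"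
proof -
  have "integrable M f" "integrable M (\<lambda>x. (f x)\<^sup>2)"
    using assms by (intro bounded_measurable_integrable bounded_measurable_intros; simp)+
  from variance_eq[OF this] variance_positive[of f] show ?thesis by simp
qed

lemma integral_add_power2_le:
  fixes f g :: "'a \<Rightarrow> real"
  assumes "bounded_measurable M f" "bounded_measurable M g"
  shows "(\<integral>x. (f x + g x)\<^sup>2 \<partial>M) \<le> 2 * (\<integral>x. (f x)\<^sup>2 \<partial>M) + 2 * (\<integral>x. (g x)\<^sup>2 \<partial>M)"
proof -
  have i: "integrable M (\<lambda>x. (f x)\<^sup>2)" "integrable M (\<lambda>x. (g x)\<^sup>2)" "integrable M (\<lambda>x. (f x + g x)\<^sup>2)"
    using assms by (intro bounded_measurable_integrable bounded_measurable_intros; simp)+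
  have "(\<integral>x. (f x + g x)\<^sup>2 \<partial>M) \<le> (\<integral>x. 2 * (f x)\<^sup>2 + 2 * (g x)\<^sup>2 \<partial>M)"
  proof (rule integral_mono)
    fix x
    have "0 \<le> (f x - g x)\<^sup>2" by simp
    then show "(f x + g x)\<^sup>2 \<le> 2 * (f x)\<^sup>2 + 2 * (g x)\<^sup>2" by (simp add: power2_sum power2_diff)
  qed (use i in auto)
  then show ?thesis using i by simp
qed

end

section \<open>Mean absolute correlations and van der Corput's lemma\<close>

lemma average_abs_power2_le:
  fixes a :: "nat \<Rightarrow> nat \<Rightarrow> real"
  shows "((\<Sum>h<H. \<Sum>k<H. \<bar>a h k\<bar>) / (real H)\<^sup>2)\<^sup>2 \<le> (\<Sum>h<H. \<Sum>k<H. (a h k)\<^sup>2) / (real H)\<^sup>2"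
proof (cases "H = 0")
  case False
  let ?S = "{..<H} \<times> {..<H}"
  have "(\<Sum>z\<in>?S. \<bar>a (fst z) (snd z)\<bar> * 1)\<^sup>2 \<le> (\<Sum>z\<in>?S. \<bar>a (fst z) (snd z)\<bar>\<^sup>2) * (\<Sum>z\<in>?S. 1\<^sup>2)"
    by (rule Cauchy_Schwarz_ineq_sum)
  then have "(\<Sum>h<H. \<Sum>k<H. \<bar>a h k\<bar>)\<^sup>2 \<le> (\<Sum>h<H. \<Sum>k<H. (a h k)\<^sup>2) * (real H)\<^sup>2"
    by (simp add: sum.cartesian_product split_beta' power2_eq_square)
  then show ?thesis
    using False by (simp add: power_divide divide_simps power2_eq_square mult.assoc)
qed simp

lemma funpow_map_prod:
  fixes T :: "'a \<Rightarrow> 'a"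
  shows "(map_prod T T ^^ n) z = ((T ^^ n) (fst z), (T ^^ n) (snd z))"
  by (induction n) auto

text \<open>With \<open>F\<close> the tensor square of \<open>f\<close>, the square of a correlation
  of \<open>f\<close> is a correlation of \<open>F\<close> in the product system. Hence the mean of
  these squares over \<open>h\<close> and \<open>k\<close> is the squared \<open>L\<^sup>2\<close>
  norm of a Birkhoff average of \<open>F\<close>, and this tends to \<open>0\<close> because
  \<open>F\<close> has integral \<open>(integral\<^sup>L M f)\<^sup>2 = 0\<close>.\<close>

lemma autocorrelation_average:
  fixes f :: "'a \<Rightarrow> real"
  assumes "prob_space M" and mp: "measure_preserving M T"
    and erg: "ergodic (M \<Otimes>\<^sub>M M) (map_prod T T)"
    and f: "bounded_measurable M f" and zero: "integral\<^sup>L M f = 0"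
  shows "(\<lambda>H. (\<Sum>h<H. \<Sum>k<H. \<bar>\<integral>x. f ((T ^^ h) x) * f ((T ^^ k) x) \<partial>M\<bar>) / (real H)\<^sup>2) \<longlonglongrightarrow> 0"
proof -
  interpret prob_space M by fact
  interpret P: pair_prob_space M M ..
  have T_m[measurable]: "T ^^ m \<in> measurable M M" for m
    using measure_preserving_funpow_measurable[OF mp] .
  note [measurable] = bounded_measurableD[OF f]
  define a where "a h k = (\<integral>x. f ((T ^^ h) x) * f ((T ^^ k) x) \<partial>M)" for h k
  have prod_int: "(\<integral>z. g (fst z) * g (snd z) \<partial>(M \<Otimes>\<^sub>M M)) = (integral\<^sup>L M g)\<^sup>2"
    if g: "bounded_measurable M g" for g :: "'a \<Rightarrow> real"
  proof -
    have "bounded_measurable (M \<Otimes>\<^sub>M M) (\<lambda>z. g (fst z) * g (snd z))"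
      by (intro bounded_measurable_mult bounded_measurable_comp[OF g]) auto
    from P.integral_fst'[OF P.bounded_measurable_integrable[OF this]]
    show ?thesis by (simp add: power2_eq_square)
  qed
  define F where "F z = f (fst z) * f (snd z)" for z
  have F: "bounded_measurable (M \<Otimes>\<^sub>M M) F"
    unfolding F_def[abs_def] by (intro bounded_measurable_mult bounded_measurable_comp[OF f]) auto
  define W where "W H z = (\<Sum>h<H. F ((map_prod T T ^^ h) z)) / real H" for H z
  have mpT: "measure_preserving (M \<Otimes>\<^sub>M M) (map_prod T T)"
    using erg by (simp add: ergodic_def)
  have FT: "bounded_measurable (M \<Otimes>\<^sub>M M) (\<lambda>z. F ((map_prod T T ^^ h) z))" for h
    using bounded_measurable_comp[OF F measure_preserving_funpow_measurable[OF mpT]] .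
  have W: "bounded_measurable (M \<Otimes>\<^sub>M M) (W H)" for H
    unfolding W_def[abs_def] by (intro bounded_measurable_intros FT)
  note [measurable] = bounded_measurableD[OF W]
  obtain C where C: "C > 0" "\<And>z. \<bar>F z\<bar> \<le> C"
    using bounded_measurable_bound[OF F] by auto
  have WC: "\<bar>W H z\<bar> \<le> C" for H z
  proof (cases "H = 0")
    case False
    have "\<bar>\<Sum>h<H. F ((map_prod T T ^^ h) z)\<bar> \<le> (\<Sum>h<H. C)"
      by (rule order_trans[OF sum_abs sum_mono]) (rule C)
    then show ?thesis using False by (simp add: W_def field_simps)
  qed (use C in \<open>simp add: W_def\<close>)
  have "AE z in M \<Otimes>\<^sub>M M. (\<lambda>H. W H z) \<longlonglongrightarrow> integral\<^sup>L (M \<Otimes>\<^sub>M M) F"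
    unfolding W_def using birkhoff_ergodic[OF P.prob_space_axioms erg P.bounded_measurable_integrable[OF F]] .
  moreover have "integral\<^sup>L (M \<Otimes>\<^sub>M M) F = 0"
    using prod_int[OF f] zero by (simp add: F_def[abs_def])
  ultimately have ae: "AE z in M \<Otimes>\<^sub>M M. (\<lambda>H. W H z) \<longlonglongrightarrow> 0" by simp
  have "(\<lambda>H. \<integral>z. (W H z)\<^sup>2 \<partial>(M \<Otimes>\<^sub>M M)) \<longlonglongrightarrow> (\<integral>z. 0 \<partial>(M \<Otimes>\<^sub>M M))"
  proof (rule integral_dominated_convergence[where w = "\<lambda>_. C\<^sup>2"])
    show "AE z in M \<Otimes>\<^sub>M M. (\<lambda>H. (W H z)\<^sup>2) \<longlonglongrightarrow> 0"
      using ae by eventually_elim (auto intro: tendsto_eq_intros)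
    fix H
    have "(W H z)\<^sup>2 \<le> C\<^sup>2" for z using WC[of H z] by (simp add: abs_le_square_iff[symmetric])
    then show "AE z in M \<Otimes>\<^sub>M M. norm ((W H z)\<^sup>2) \<le> C\<^sup>2" by simp
  qed auto
  moreover have "(\<integral>z. (W H z)\<^sup>2 \<partial>(M \<Otimes>\<^sub>M M)) = (\<Sum>h<H. \<Sum>k<H. (a h k)\<^sup>2) / (real H)\<^sup>2" for H
  proof -
    have hk: "(\<integral>z. F ((map_prod T T ^^ h) z) * F ((map_prod T T ^^ k) z) \<partial>(M \<Otimes>\<^sub>M M)) = (a h k)\<^sup>2" for h k
    proof -
      have "bounded_measurable M (\<lambda>x. f ((T ^^ h) x) * f ((T ^^ k) x))"
        by (intro bounded_measurable_mult bounded_measurable_comp[OF f T_m])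
      from prod_int[OF this] show ?thesis
        by (simp add: F_def a_def funpow_map_prod mult_ac)
    qed
    have i: "integrable (M \<Otimes>\<^sub>M M) (\<lambda>z. F ((map_prod T T ^^ h) z) * F ((map_prod T T ^^ k) z))" for h k
      by (intro P.bounded_measurable_integrable bounded_measurable_intros FT)
    have "(\<integral>z. (W H z)\<^sup>2 \<partial>(M \<Otimes>\<^sub>M M)) =
      (\<integral>z. (\<Sum>h<H. \<Sum>k<H. F ((map_prod T T ^^ h) z) * F ((map_prod T T ^^ k) z)) / (real H)\<^sup>2 \<partial>(M \<Otimes>\<^sub>M M))"
      by (simp add: W_def power_divide power2_eq_square[of "sum _ _"] sum_product)
    also have "\<dots> = (\<Sum>h<H. \<Sum>k<H. (a h k)\<^sup>2) / (real H)\<^sup>2"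
      using i by (simp add: hk)
    finally show ?thesis .
  qed
  ultimately have lim: "(\<lambda>H. (\<Sum>h<H. \<Sum>k<H. (a h k)\<^sup>2) / (real H)\<^sup>2) \<longlonglongrightarrow> 0" by simp
  \<comment> \<open>Cauchy-Schwarz over the \<open>H\<^sup>2\<close> index pairs passes from mean
    squares to mean absolute values.\<close>
  have "(\<lambda>H. ((\<Sum>h<H. \<Sum>k<H. \<bar>a h k\<bar>) / (real H)\<^sup>2)\<^sup>2) \<longlonglongrightarrow> 0"
    by (rule tendsto_sandwich[OF always_eventually always_eventually tendsto_const lim])
      (auto intro: average_abs_power2_le)
  then have "(\<lambda>H. (\<Sum>h<H. \<Sum>k<H. \<bar>a h k\<bar>) / (real H)\<^sup>2) \<longlonglongrightarrow> 0"
    by simp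
  then show ?thesis by (simp add: a_def)
qed

text \<open>Replacing each \<open>u n\<close> by its mean over a window of length \<open>H\<close>
  changes the average over \<open>n < N\<close> by \<open>O(H / N)\<close>; Cauchy-Schwarz in
  \<open>n\<close> and expansion of the squared window mean then leave only correlations. The limit
  in \<open>N\<close> is taken first, for fixed \<open>H\<close>. Keeping both shifts
  \<open>h\<close> and \<open>k\<close> as parameters avoids negative differences.\<close>

lemma van_der_corput:
  fixes u :: "nat \<Rightarrow> 'a \<Rightarrow> real"
  assumes "prob_space M" and u: "\<And>n. u n \<in> borel_measurable M" and C: "\<And>n x. \<bar>u n x\<bar> \<le> C"
    and corr: "\<And>h k. (\<lambda>N. (\<Sum>n<N. \<integral>x. u (n + h) x * u (n + k) x \<partial>M) / real N) \<longlonglongrightarrow> \<gamma> h k"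
    and \<gamma>: "(\<lambda>H. (\<Sum>h<H. \<Sum>k<H. \<gamma> h k) / (real H)\<^sup>2) \<longlonglongrightarrow> 0"
  shows "(\<lambda>N. \<integral>x. ((\<Sum>n<N. u n x) / real N)\<^sup>2 \<partial>M) \<longlonglongrightarrow> 0"
proof -
  interpret prob_space M by fact
  have bu: "bounded_measurable M (u n)" for n
    using u C by (intro bounded_measurableI[of _ _ C]) auto
  have C0: "C \<ge> 0" using C[of 0 undefined] by linarith
  \<comment> \<open>Each unit shift drops one term and adds another, at a cost of at most
    \<open>2 * C\<close>.\<close>
  have shift: "\<bar>(\<Sum>n<N. u n x) - (\<Sum>n<N. u (n + h) x)\<bar> \<le> 2 * C * real h" for N h x
  proof (induction h)
    case (Suc h)
    have "(\<Sum>n<N. u (n + Suc h) x) - (\<Sum>n<N. u (n + h) x) = u (N + h) x - u h x"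
      using sum_lessThan_telescope[of "\<lambda>n. u (n + h) x" N] by (simp add: sum_subtractf)
    moreover have "\<bar>u (N + h) x - u h x\<bar> \<le> 2 * C"
      using C[of "N + h" x] C[of h x] by linarith
    ultimately show ?case using Suc by (simp add: algebra_simps)
  qed simp
  define A where "A N x = (\<Sum>n<N. u n x) / real N" for N x
  define v where "v H n x = (\<Sum>h<H. u (n + h) x) / real H" for H n x
  have bA: "bounded_measurable M (A N)" for N
    unfolding A_def[abs_def] by (intro bounded_measurable_intros bu)
  have bv: "bounded_measurable M (v H n)" for H n
    unfolding v_def[abs_def] by (intro bounded_measurable_intros bu)
  define V where "V H N x = (\<Sum>n<N. v H n x) / real N" for H N x
  have bV: "bounded_measurable M (V H N)" for H N
    unfolding V_def[abs_def] by (intro bounded_measurable_intros bv)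
  have AV: "\<bar>A N x - V H N x\<bar> \<le> 2 * C * real H / real N" if "H \<ge> 1" for H N x
  proof -
    have "(\<Sum>n<N. v H n x) = (\<Sum>h<H. \<Sum>n<N. u (n + h) x) / real H"
      unfolding v_def by (subst sum.swap) (simp add: sum_divide_distrib)
    then have "real H * ((\<Sum>n<N. u n x) - (\<Sum>n<N. v H n x)) = (\<Sum>h<H. (\<Sum>n<N. u n x) - (\<Sum>n<N. u (n + h) x))"
      using that by (simp add: sum_subtractf algebra_simps)
    then have "real H * \<bar>(\<Sum>n<N. u n x) - (\<Sum>n<N. v H n x)\<bar> = \<bar>\<Sum>h<H. (\<Sum>n<N. u n x) - (\<Sum>n<N. u (n + h) x)\<bar>"
      by (metis abs_mult abs_of_nat)
    also have "\<dots> \<le> (\<Sum>h<H. 2 * C * real H)"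
    proof (rule order_trans[OF sum_abs sum_mono])
      fix h assume "h \<in> {..<H}"
      then have "2 * C * real h \<le> 2 * C * real H" using C0 by (intro mult_left_mono) auto
      then show "\<bar>(\<Sum>n<N. u n x) - (\<Sum>n<N. u (n + h) x)\<bar> \<le> 2 * C * real H"
        using shift[of x N h] by linarith
    qed
    finally have "\<bar>(\<Sum>n<N. u n x) - (\<Sum>n<N. v H n x)\<bar> \<le> 2 * C * real H"
      using that by simp
    then have "\<bar>(\<Sum>n<N. u n x) - (\<Sum>n<N. v H n x)\<bar> / real N \<le> 2 * C * real H / real N"
      by (rule divide_right_mono) simp
    then show ?thesis by (simp add: A_def V_def flip: diff_divide_distrib)
  qed
  \<comment> \<open>The first term holds the window correlations, which converge for fixed
    \<open>H\<close>; the second is the boundary error, which vanishes as \<open>N\<close> grows.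
    The factors \<open>2\<close> in front come from squaring a sum of two terms.\<close>
  define r where "r H N = 2 * ((\<Sum>h<H. \<Sum>k<H. (\<Sum>n<N. \<integral>x. u (n + h) x * u (n + k) x \<partial>M) / real N) / (real H)\<^sup>2)
      + 2 * (2 * C * real H / real N)\<^sup>2" for H N
  have bound: "(\<integral>x. (A N x)\<^sup>2 \<partial>M) \<le> r H N" if H: "H \<ge> 1" for H N
  proof -
    have "(\<integral>x. (A N x)\<^sup>2 \<partial>M) = (\<integral>x. (V H N x + (A N x - V H N x))\<^sup>2 \<partial>M)" by simp
    also have "\<dots> \<le> 2 * (\<integral>x. (V H N x)\<^sup>2 \<partial>M) + 2 * (\<integral>x. (A N x - V H N x)\<^sup>2 \<partial>M)"
      by (intro integral_add_power2_le bounded_measurable_intros bA bV)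
    also have "(\<integral>x. (A N x - V H N x)\<^sup>2 \<partial>M) \<le> (\<integral>x. (2 * C * real H / real N)\<^sup>2 \<partial>M)"
    proof (rule integral_mono)
      show "integrable M (\<lambda>x. (A N x - V H N x)\<^sup>2)" by (intro bounded_measurable_integrable bounded_measurable_intros bA bV)
      show "(A N x - V H N x)\<^sup>2 \<le> (2 * C * real H / real N)\<^sup>2" for x
        using AV[OF H, of N x] C0 by (simp flip: abs_le_square_iff)
    qed simp
    also have "\<dots> = (2 * C * real H / real N)\<^sup>2" by (simp add: prob_space)
    also have "(\<integral>x. (V H N x)\<^sup>2 \<partial>M) \<le> (\<integral>x. (\<Sum>n<N. (v H n x)\<^sup>2) / real N \<partial>M)"
    proof (rule integral_mono)
      show "integrable M (\<lambda>x. (V H N x)\<^sup>2)" by (intro bounded_measurable_integrable bounded_measurable_intros bV)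
      show "integrable M (\<lambda>x. (\<Sum>n<N. (v H n x)\<^sup>2) / real N)" by (intro bounded_measurable_integrable bounded_measurable_intros bv)
      fix x
      have "(\<Sum>n<N. v H n x * 1)\<^sup>2 \<le> (\<Sum>n<N. (v H n x)\<^sup>2) * (\<Sum>n<N. 1\<^sup>2)"
        by (rule Cauchy_Schwarz_ineq_sum)
      then show "(V H N x)\<^sup>2 \<le> (\<Sum>n<N. (v H n x)\<^sup>2) / real N"
        by (cases "N = 0") (auto simp: V_def power_divide divide_simps power2_eq_square mult_ac)
    qed
    also have "\<dots> = (\<Sum>h<H. \<Sum>k<H. (\<Sum>n<N. \<integral>x. u (n + h) x * u (n + k) x \<partial>M) / real N) / (real H)\<^sup>2"
    proof -
      have i: "integrable M (\<lambda>x. u m x * u n x)" for m n by (intro bounded_measurable_integrable bounded_measurable_intros bu)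
      have vv: "(\<integral>x. (v H n x)\<^sup>2 \<partial>M) = (\<Sum>h<H. \<Sum>k<H. \<integral>x. u (n + h) x * u (n + k) x \<partial>M) / (real H)\<^sup>2" for n
        using i by (simp add: v_def power_divide power2_eq_square[of "sum _ _"] sum_product)
      have "(\<integral>x. (\<Sum>n<N. (v H n x)\<^sup>2) / real N \<partial>M) = (\<Sum>n<N. (\<integral>x. (v H n x)\<^sup>2 \<partial>M)) / real N"
        using bounded_measurable_integrable[OF bounded_measurable_power2[OF bv]] by simp
      also have "\<dots> = (\<Sum>n<N. \<Sum>h<H. \<Sum>k<H. \<integral>x. u (n + h) x * u (n + k) x \<partial>M) / (real H)\<^sup>2 / real N"
        by (simp add: vv sum_divide_distrib)
      also have "(\<Sum>n<N. \<Sum>h<H. \<Sum>k<H. \<integral>x. u (n + h) x * u (n + k) x \<partial>M)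
          = (\<Sum>h<H. \<Sum>k<H. \<Sum>n<N. \<integral>x. u (n + h) x * u (n + k) x \<partial>M)"
        by (subst sum.swap) (intro sum.cong refl sum.swap)
      finally show ?thesis by (simp add: sum_divide_distrib mult.commute)
    qed
    finally show ?thesis by (simp add: r_def)
  qed
  have r_lim: "r H \<longlonglongrightarrow> 2 * ((\<Sum>h<H. \<Sum>k<H. \<gamma> h k) / (real H)\<^sup>2) + 2 * 0\<^sup>2" if "H \<ge> 1" for H
    unfolding r_def[abs_def]
    by (intro tendsto_add tendsto_mult tendsto_const tendsto_divide tendsto_sum corr tendsto_power lim_const_over_n)
      (use that in auto)
  have "(\<lambda>N. \<integral>x. (A N x)\<^sup>2 \<partial>M) \<longlonglongrightarrow> 0"
  proof (rule order_tendstoI)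
    fix e :: real assume "0 < e"
    then have "eventually (\<lambda>H. (\<Sum>h<H. \<Sum>k<H. \<gamma> h k) / (real H)\<^sup>2 < e / 2 \<and> H \<ge> 1) sequentially"
      using order_tendstoD(2)[OF \<gamma>, of "e / 2"] eventually_ge_at_top[of 1] by (simp add: eventually_conj_iff)
    then obtain H where H: "(\<Sum>h<H. \<Sum>k<H. \<gamma> h k) / (real H)\<^sup>2 < e / 2" "H \<ge> 1"
      by (auto simp: eventually_sequentially)
    then have "eventually (\<lambda>N. r H N < e) sequentially"
      by (intro order_tendstoD(2)[OF r_lim]) (auto simp: mult.commute)
    then show "eventually (\<lambda>N. (\<integral>x. (A N x)\<^sup>2 \<partial>M) < e) sequentially"
      by eventually_elim (use bound[OF H(2)] le_less_trans in blast)
  next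
    fix e :: real assume "e < 0"
    moreover have "0 \<le> (\<integral>x. (A N x)\<^sup>2 \<partial>M)" for N by simp
    ultimately show "eventually (\<lambda>N. e < (\<integral>x. (A N x)\<^sup>2 \<partial>M)) sequentially"
      by (intro always_eventually) (meson less_le_trans)
  qed
  then show ?thesis by (simp add: A_def)
qed

subsection \<open>Mean convergence of multiple averages\<close>

lemma invertible_mpt_comp:
  assumes "invertible_mpt M S" "invertible_mpt M T"
  shows "invertible_mpt M (S \<circ> T)"
proof -
  have "bij S" "bij T" "inv S \<in> measurable M M" "inv T \<in> measurable M M"
    "measure_preserving M S" "measure_preserving M T"
    using assms by (auto simp: invertible_mpt_def)
  then show ?thesis
    unfolding invertible_mpt_def
    by (simp add: bij_comp o_inv_distrib measure_preserving_comp)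
qed

lemma invertible_mpt_inv:
  assumes "invertible_mpt M T"
  shows "invertible_mpt M (inv T)"
  using assms measure_preserving_inv[OF assms]
  by (simp add: invertible_mpt_def inv_inv_eq bij_imp_bij_inv measure_preserving_def)

lemma comp_inv_commute:
  assumes "bij T" "S \<circ> T = T \<circ> S"
  shows "S \<circ> inv T = inv T \<circ> S"
proof
  fix x
  have "S (T (inv T x)) = T (S (inv T x))" using fun_cong[OF assms(2)] by simp
  then show "(S \<circ> inv T) x = (inv T \<circ> S) x"
    using assms(1) by (simp add: bij_is_surj surj_f_inv_f bij_is_inj inv_f_f)
qed

lemma funpow_comp_commute:
  fixes S T :: "'a \<Rightarrow> 'a"
  assumes "S \<circ> T = T \<circ> S"
  shows "((S \<circ> T) ^^ n) x = (S ^^ n) ((T ^^ n) x)"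
proof (induction n)
  case (Suc n)
  have c: "T ((S ^^ n) y) = (S ^^ n) (T y)" for y
    by (induction n) (use fun_cong[OF assms[symmetric]] in auto)
  show ?case using Suc c by simp
qed simp

text \<open>Ergodicity is required of Cartesian squares, the form that the autocorrelation estimate
  consumes. The index type is arbitrary, so that removing an index needs no renumbering.\<close>

definition mixing_family :: "'a measure \<Rightarrow> 'i set \<Rightarrow> ('i \<Rightarrow> 'a \<Rightarrow> 'a) \<Rightarrow> bool" where
  "mixing_family M I T \<longleftrightarrow> finite I \<and> (\<forall>i\<in>I. invertible_mpt M (T i)) \<and>
     (\<forall>i\<in>I. \<forall>j\<in>I. T i \<circ> T j = T j \<circ> T i) \<and>
     (\<forall>i\<in>I. ergodic (M \<Otimes>\<^sub>M M) (map_prod (T i) (T i))) \<and>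
     (\<forall>i\<in>I. \<forall>j\<in>I. i \<noteq> j \<longrightarrow>
        ergodic (M \<Otimes>\<^sub>M M) (map_prod (T i \<circ> inv (T j)) (T i \<circ> inv (T j))))"

text \<open>The quotient condition of the old family is the single-map condition of the new one. It
  also survives as the new quotient condition, since \<open>inv (T j)\<close> cancels in the
  quotient of \<open>T i \<circ> inv (T j)\<close> and \<open>T l \<circ> inv (T j)\<close>.\<close>

lemma mixing_family_difference:
  assumes fam: "mixing_family M I T" and j: "j \<in> I"
  shows "mixing_family M (I - {j}) (\<lambda>i. T i \<circ> inv (T j))"
proof -
  have bij: "bij (T i)" if "i \<in> I" for i
    using fam that by (auto simp: mixing_family_def invertible_mpt_def)
  have comm: "T i \<circ> T l = T l \<circ> T i" if "i \<in> I" "l \<in> I" for i l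
    using fam that by (auto simp: mixing_family_def)
  have c1: "T i (inv (T j) x) = inv (T j) (T i x)" if "i \<in> I" for i x
    using fun_cong[OF comp_inv_commute[OF bij[OF j] comm[OF that j]]] by simp
  have 1: "(T i \<circ> inv (T j)) \<circ> (T l \<circ> inv (T j)) = (T l \<circ> inv (T j)) \<circ> (T i \<circ> inv (T j))"
    if "i \<in> I" "l \<in> I" for i l
  proof
    fix x
    have "T i (inv (T j) (T l (inv (T j) x))) = T i (T l (inv (T j) (inv (T j) x)))"
      by (simp only: c1[OF that(2), symmetric])
    also have "\<dots> = T l (T i (inv (T j) (inv (T j) x)))"
      using fun_cong[OF comm[OF that]] by simp
    also have "\<dots> = T l (inv (T j) (T i (inv (T j) x)))"
      by (simp only: c1[OF that(1), symmetric])
    finally show "((T i \<circ> inv (T j)) \<circ> (T l \<circ> inv (T j))) x = ((T l \<circ> inv (T j)) \<circ> (T i \<circ> inv (T j))) x"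
      by simp
  qed
  have 2: "(T i \<circ> inv (T j)) \<circ> inv (T l \<circ> inv (T j)) = T i \<circ> inv (T l)"
    if "i \<in> I" "l \<in> I" for i l
  proof -
    have "inv (T l \<circ> inv (T j)) = T j \<circ> inv (T l)"
      using bij[OF j] bij[OF that(2)] by (simp add: o_inv_distrib bij_imp_bij_inv inv_inv_eq)
    then show ?thesis
      using bij[OF j] by (auto simp: fun_eq_iff bij_is_inj inv_f_f)
  qed
  have 3: "invertible_mpt M (T i \<circ> inv (T j))" if "i \<in> I" for i
    using fam that j by (intro invertible_mpt_comp invertible_mpt_inv) (auto simp: mixing_family_def)
  show ?thesis
    using fam j 1 2 3 unfolding mixing_family_def by simp
qed

text \<open>The field is left open: mean convergence is proved for real values, almost everywhere
  convergence for complex ones. The sum starts at \<open>0\<close> to match Birkhoff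
  averages.\<close>

definition multi_average :: "'i set \<Rightarrow> ('i \<Rightarrow> 'a \<Rightarrow> 'a) \<Rightarrow> ('i \<Rightarrow> 'a \<Rightarrow> 'b::real_normed_field) \<Rightarrow> nat \<Rightarrow> 'a \<Rightarrow> 'b"
  where "multi_average I T f N x = (\<Sum>n<N. \<Prod>i\<in>I. f i ((T i ^^ n) x)) / of_nat N"

lemma multi_average_bounded_measurable:
  fixes f :: "'i \<Rightarrow> 'a \<Rightarrow> real"
  assumes mp: "\<And>i. i \<in> I \<Longrightarrow> measure_preserving M (T i)" and f: "\<And>i. i \<in> I \<Longrightarrow> bounded_measurable M (f i)"
  shows "bounded_measurable M (multi_average I T f N)"
  unfolding multi_average_def[abs_def]
  by (intro bounded_measurable_intros bounded_measurable_comp[OF f] measure_preserving_funpow_measurable mp)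

lemma multi_average_add:
  fixes f :: "'i \<Rightarrow> 'a \<Rightarrow> 'b::real_normed_field"
  assumes "finite I" "i \<in> I"
  shows "multi_average I T (f(i := \<lambda>x. g x + h x)) N x =
    multi_average I T (f(i := g)) N x + multi_average I T (f(i := h)) N x"
proof -
  have "(\<Prod>l\<in>I. (f(i := q)) l ((T l ^^ n) x)) = q ((T i ^^ n) x) * (\<Prod>l\<in>I - {i}. f l ((T l ^^ n) x))"
    for q n
    using assms by (simp add: prod.remove)
  then show ?thesis
    by (simp add: multi_average_def distrib_right sum.distrib add_divide_distrib)
qed

lemma prod_integral_upd:
  fixes f :: "'i \<Rightarrow> 'a \<Rightarrow> 'b::{real_normed_field,banach,second_countable_topology}"
  assumes "finite I" "i \<in> I"
  shows "(\<Prod>l\<in>I. integral\<^sup>L M ((f(i := q)) l)) = integral\<^sup>L M q * (\<Prod>l\<in>I - {i}. integral\<^sup>L M (f l))"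
  using assms by (simp add: prod.remove)

text \<open>Composing with the inverse of one of the transformations reduces a correlation to an
  average over a family with one transformation fewer.\<close>

lemma correlation_limit:
  fixes g :: "'i \<Rightarrow> 'a \<Rightarrow> real"
  assumes "prob_space M" and fam: "mixing_family M I T" and j: "j \<in> I"
    and IH: "(\<lambda>N. \<integral>x. (multi_average (I - {j}) (\<lambda>i. T i \<circ> inv (T j)) g N x
        - (\<Prod>i\<in>I - {j}. integral\<^sup>L M (g i)))\<^sup>2 \<partial>M) \<longlonglongrightarrow> 0"
    and g: "\<And>i. i \<in> I \<Longrightarrow> bounded_measurable M (g i)"
  shows "(\<lambda>N. (\<Sum>n<N. \<integral>x. (\<Prod>i\<in>I. g i ((T i ^^ n) x)) \<partial>M) / real N)
    \<longlonglongrightarrow> (\<Prod>i\<in>I. integral\<^sup>L M (g i))"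
proof -
  interpret prob_space M by fact
  let ?S = "\<lambda>i. T i \<circ> inv (T j)"
  let ?L = "\<Prod>i\<in>I - {j}. integral\<^sup>L M (g i)"
  let ?A = "multi_average (I - {j}) ?S g"
  have fin: "finite I" using fam by (simp add: mixing_family_def)
  have mp: "measure_preserving M (T i)" if "i \<in> I" for i
    using fam that by (auto simp: mixing_family_def invertible_mpt_def)
  have mpS: "measure_preserving M (?S i)" if "i \<in> I - {j}" for i
    using mixing_family_difference[OF fam j] that by (auto simp: mixing_family_def invertible_mpt_def)
  have bijj: "bij (T j)" using fam j by (auto simp: mixing_family_def invertible_mpt_def)
  \<comment> \<open>\<open>T i\<close> is \<open>?S i\<close> composed with \<open>T j\<close>, and
    these two commute, so the \<open>n\<close>-th power splits.\<close>
  have pow: "(T i ^^ n) x = (?S i ^^ n) ((T j ^^ n) x)" if "i \<in> I" for i n x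
  proof -
    have "T i \<circ> T j = T j \<circ> T i" using fam that j by (auto simp: mixing_family_def)
    from fun_cong[OF comp_inv_commute[OF bijj this]] fun_cong[OF this]
    have "?S i \<circ> T j = T j \<circ> ?S i"
      using bijj by (auto simp: fun_eq_iff bij_is_inj inv_f_f bij_is_surj surj_f_inv_f)
    from funpow_comp_commute[OF this] have "((?S i \<circ> T j) ^^ n) x = (?S i ^^ n) ((T j ^^ n) x)" .
    moreover have "?S i \<circ> T j = T i" using bijj by (auto simp: fun_eq_iff bij_is_inj inv_f_f)
    ultimately show ?thesis by simp
  qed
  have bS: "bounded_measurable M (\<lambda>x. \<Prod>i\<in>I - {j}. g i ((?S i ^^ n) x))" for n
    by (intro bounded_measurable_intros bounded_measurable_comp[OF g] measure_preserving_funpow_measurable mpS) auto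
  have bj: "bounded_measurable M (g j)" using g j by simp
  \<comment> \<open>Every factor depends on \<open>x\<close> only through
    \<open>(T j ^^ n) x\<close>, which invariance of \<open>M\<close> replaces by \<open>x\<close>.
    The factor at \<open>j\<close> thereby becomes free of \<open>n\<close> and can be pulled out of
    the average.\<close>
  have "(\<integral>x. (\<Prod>i\<in>I. g i ((T i ^^ n) x)) \<partial>M) = (\<integral>x. g j x * (\<Prod>i\<in>I - {j}. g i ((?S i ^^ n) x)) \<partial>M)" for n
  proof -
    have "(\<Prod>i\<in>I. g i ((T i ^^ n) x))
        = g j ((T j ^^ n) x) * (\<Prod>i\<in>I - {j}. g i ((?S i ^^ n) ((T j ^^ n) x)))" for x
    proof -
      have "(\<Prod>i\<in>I - {j}. g i ((T i ^^ n) x)) = (\<Prod>i\<in>I - {j}. g i ((?S i ^^ n) ((T j ^^ n) x)))"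
        by (rule prod.cong) (auto simp only: pow Diff_iff)
      then show ?thesis using fin j by (simp only: prod.remove)
    qed
    then show ?thesis
      using measure_preserving_integral[OF measure_preserving_funpow[OF mp[OF j]]
          bounded_measurableD[OF bounded_measurable_mult[OF bj bS]]] by simp
  qed
  then have eq: "(\<Sum>n<N. \<integral>x. (\<Prod>i\<in>I. g i ((T i ^^ n) x)) \<partial>M) / real N = (\<integral>x. g j x * ?A N x \<partial>M)" for N
    using bounded_measurable_integrable[OF bounded_measurable_mult[OF bj bS]]
    by (simp add: multi_average_def sum_distrib_left)
  obtain C where C: "C > 0" "\<And>x. \<bar>g j x\<bar> \<le> C"
    using bounded_measurable_bound[OF bj] by auto
  have bA: "bounded_measurable M (?A N)" for N
    by (rule multi_average_bounded_measurable) (use mpS g in auto)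
  \<comment> \<open>Bounding \<open>g j\<close> by \<open>C\<close> and a mean absolute value by the
    root mean square turns \<open>L\<^sup>2\<close> convergence of the smaller averages into
    convergence of their pairing with \<open>g j\<close>.\<close>
  have bound: "\<bar>(\<integral>x. g j x * ?A N x \<partial>M) - integral\<^sup>L M (g j) * ?L\<bar>
      \<le> C * sqrt (\<integral>x. (?A N x - ?L)\<^sup>2 \<partial>M)" for N
  proof -
    have "(\<integral>x. g j x * ?A N x \<partial>M) - integral\<^sup>L M (g j) * ?L = (\<integral>x. g j x * (?A N x - ?L) \<partial>M)"
      using bounded_measurable_integrable[OF bounded_measurable_mult[OF bj bA, of N]]
        bounded_measurable_integrable[OF bj]
      by (simp add: right_diff_distrib)
    also have "\<bar>\<dots>\<bar> \<le> (\<integral>x. \<bar>g j x * (?A N x - ?L)\<bar> \<partial>M)" by (rule integral_abs_bound)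
    also have "\<dots> \<le> (\<integral>x. C * \<bar>?A N x - ?L\<bar> \<partial>M)"
    proof (rule integral_mono)
      show "integrable M (\<lambda>x. \<bar>g j x * (?A N x - ?L)\<bar>)" "integrable M (\<lambda>x. C * \<bar>?A N x - ?L\<bar>)"
        by (intro bounded_measurable_integrable bounded_measurable_intros bj bA)+
      show "\<bar>g j x * (?A N x - ?L)\<bar> \<le> C * \<bar>?A N x - ?L\<bar>" for x
        using C by (simp add: abs_mult mult_right_mono)
    qed
    also have "\<dots> = C * (\<integral>x. \<bar>?A N x - ?L\<bar> \<partial>M)" by simp
    also have "\<dots> \<le> C * sqrt (\<integral>x. (?A N x - ?L)\<^sup>2 \<partial>M)"
    proof -
      have "bounded_measurable M (\<lambda>x. \<bar>?A N x - ?L\<bar>)"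
        by (intro bounded_measurable_intros bA)
      from integral_power2_le[OF this] show ?thesis
        using C by (intro mult_left_mono real_le_rsqrt) auto
    qed
    finally show ?thesis .
  qed
  have "(\<lambda>N. C * sqrt (\<integral>x. (?A N x - ?L)\<^sup>2 \<partial>M)) \<longlonglongrightarrow> C * sqrt 0"
    by (intro tendsto_intros IH)
  then have "(\<lambda>N. C * sqrt (\<integral>x. (?A N x - ?L)\<^sup>2 \<partial>M)) \<longlonglongrightarrow> 0" by simp
  then have "(\<lambda>N. (\<integral>x. g j x * ?A N x \<partial>M) - integral\<^sup>L M (g j) * ?L) \<longlonglongrightarrow> 0"
    by (rule Lim_null_comparison[OF always_eventually, rotated]) (use bound in simp)
  then have "(\<lambda>N. (\<integral>x. g j x * ?A N x \<partial>M)) \<longlonglongrightarrow> integral\<^sup>L M (g j) * ?L"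
    by (rule LIM_zero_cancel)
  then show ?thesis
    unfolding eq using fin j by (simp add: prod.remove)
qed

lemma prod_abs_le:
  fixes a :: "'i \<Rightarrow> real"
  assumes "\<And>i. i \<in> I \<Longrightarrow> \<bar>a i\<bar> \<le> C i"
  shows "\<bar>\<Prod>i\<in>I. a i\<bar> \<le> (\<Prod>i\<in>I. C i)"
  unfolding abs_prod using assms by (intro prod_mono) auto

text \<open>A product of two shifted terms of the sum is again a product along the family, with each
  \<open>f i\<close> replaced by a product of two of its iterates, so \<open>corr\<close> identifies
  the correlations required by van der Corput's lemma as products of autocorrelations. The factor at
  \<open>i0\<close> has small mean absolute value because \<open>f i0\<close> has mean zero; the
  others are merely bounded.\<close>

lemma multi_average_zero_mean:
  fixes f :: "'i \<Rightarrow> 'a \<Rightarrow> real"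
  assumes "prob_space M" and fam: "mixing_family M I T"
    and corr: "\<And>g :: 'i \<Rightarrow> 'a \<Rightarrow> real. (\<And>i. i \<in> I \<Longrightarrow> bounded_measurable M (g i)) \<Longrightarrow>
      (\<lambda>N. (\<Sum>n<N. \<integral>x. (\<Prod>i\<in>I. g i ((T i ^^ n) x)) \<partial>M) / real N)
      \<longlonglongrightarrow> (\<Prod>i\<in>I. integral\<^sup>L M (g i))"
    and f: "\<And>i. i \<in> I \<Longrightarrow> bounded_measurable M (f i)"
    and i0: "i0 \<in> I" and zero: "integral\<^sup>L M (f i0) = 0"
  shows "(\<lambda>N. \<integral>x. (multi_average I T f N x)\<^sup>2 \<partial>M) \<longlonglongrightarrow> 0"
proof -
  interpret prob_space M by fact
  have fin: "finite I" using fam by (simp add: mixing_family_def)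
  have mp: "measure_preserving M (T i)" if "i \<in> I" for i
    using fam that by (auto simp: mixing_family_def invertible_mpt_def)
  have "\<forall>i\<in>I. \<exists>C>0. \<forall>x. \<bar>f i x\<bar> \<le> C"
    using f bounded_measurable_bound by (metis real_norm_def)
  then obtain C where C: "\<And>i. i \<in> I \<Longrightarrow> C i > 0" "\<And>i x. i \<in> I \<Longrightarrow> \<bar>f i x\<bar> \<le> C i"
    by metis
  define u where "u n x = (\<Prod>i\<in>I. f i ((T i ^^ n) x))" for n x
  define a where "a i h k = (\<integral>x. f i ((T i ^^ h) x) * f i ((T i ^^ k) x) \<partial>M)" for i h k
  have bff: "bounded_measurable M (\<lambda>x. f i ((T i ^^ h) x) * f i ((T i ^^ k) x))" if "i \<in> I" for i h k
    by (intro bounded_measurable_intros bounded_measurable_comp[OF f] measure_preserving_funpow_measurable mp that)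
  have a_bd: "\<bar>a i h k\<bar> \<le> (C i)\<^sup>2" if "i \<in> I" for i h k
    unfolding a_def
  proof (rule abs_integral_le)
    show "(\<lambda>x. f i ((T i ^^ h) x) * f i ((T i ^^ k) x)) \<in> borel_measurable M"
      using bff[OF that] by (rule bounded_measurableD)
    show "\<bar>f i ((T i ^^ h) x) * f i ((T i ^^ k) x)\<bar> \<le> (C i)\<^sup>2" for x
      unfolding abs_mult power2_eq_square using C that by (intro mult_mono) (auto simp: less_imp_le)
  qed
  have "(\<lambda>N. \<integral>x. ((\<Sum>n<N. u n x) / real N)\<^sup>2 \<partial>M) \<longlonglongrightarrow> 0"
  proof (rule van_der_corput[OF assms(1)])
    show "u n \<in> borel_measurable M" for n
      unfolding u_def[abs_def]
      by (intro bounded_measurableD bounded_measurable_intros bounded_measurable_comp[OF f]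
          measure_preserving_funpow_measurable mp)
    show "\<bar>u n x\<bar> \<le> (\<Prod>i\<in>I. C i)" for n x
      unfolding u_def using C by (intro prod_abs_le) auto
    show "(\<lambda>N. (\<Sum>n<N. \<integral>x. u (n + h) x * u (n + k) x \<partial>M) / real N) \<longlonglongrightarrow> (\<Prod>i\<in>I. a i h k)" for h k
    proof -
      have "(\<lambda>N. (\<Sum>n<N. \<integral>x. (\<Prod>i\<in>I. f i ((T i ^^ h) ((T i ^^ n) x)) * f i ((T i ^^ k) ((T i ^^ n) x))) \<partial>M) / real N)
        \<longlonglongrightarrow> (\<Prod>i\<in>I. a i h k)"
        unfolding a_def using bff by (rule corr)
      moreover have "(T i ^^ (n + m)) x = (T i ^^ m) ((T i ^^ n) x)" for i n m x
        by (simp add: funpow_add add.commute[of n m])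
      ultimately show ?thesis
        by (simp add: u_def prod.distrib)
    qed
    define K where "K = (\<Prod>i\<in>I - {i0}. (C i)\<^sup>2)"
    have lim: "(\<lambda>H. K * ((\<Sum>h<H. \<Sum>k<H. \<bar>a i0 h k\<bar>) / (real H)\<^sup>2)) \<longlonglongrightarrow> K * 0"
      unfolding a_def
      by (intro tendsto_mult tendsto_const autocorrelation_average[OF assms(1) mp[OF i0]])
        (use f i0 zero fam in \<open>auto simp: mixing_family_def\<close>)
    have bound: "norm ((\<Sum>h<H. \<Sum>k<H. \<Prod>i\<in>I. a i h k) / (real H)\<^sup>2)
        \<le> K * ((\<Sum>h<H. \<Sum>k<H. \<bar>a i0 h k\<bar>) / (real H)\<^sup>2)" for H
    proof -
      have "\<bar>\<Prod>i\<in>I. a i h k\<bar> \<le> K * \<bar>a i0 h k\<bar>" for h k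
      proof -
        have "(\<Prod>i\<in>I. a i h k) = a i0 h k * (\<Prod>i\<in>I - {i0}. a i h k)"
          using fin i0 by (simp add: prod.remove)
        moreover have "\<bar>\<Prod>i\<in>I - {i0}. a i h k\<bar> \<le> K"
          unfolding K_def using a_bd by (intro prod_abs_le) auto
        ultimately show ?thesis
          using mult_left_mono[of "\<bar>\<Prod>i\<in>I - {i0}. a i h k\<bar>" K "\<bar>a i0 h k\<bar>"]
          by (simp add: abs_mult mult.commute)
      qed
      then have "\<bar>\<Sum>h<H. \<Sum>k<H. \<Prod>i\<in>I. a i h k\<bar> \<le> (\<Sum>h<H. \<Sum>k<H. K * \<bar>a i0 h k\<bar>)"
        by (intro order_trans[OF sum_abs sum_mono]) auto
      then have "\<bar>\<Sum>h<H. \<Sum>k<H. \<Prod>i\<in>I. a i h k\<bar> / (real H)\<^sup>2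
          \<le> (\<Sum>h<H. \<Sum>k<H. K * \<bar>a i0 h k\<bar>) / (real H)\<^sup>2"
        by (rule divide_right_mono) simp
      then show ?thesis by (simp add: sum_distrib_left)
    qed
    show "(\<lambda>H. (\<Sum>h<H. \<Sum>k<H. \<Prod>i\<in>I. a i h k) / (real H)\<^sup>2) \<longlonglongrightarrow> 0"
      by (rule Lim_null_comparison[OF always_eventually lim[simplified mult_zero_right]]) (use bound in blast)
  qed
  then show ?thesis by (simp add: multi_average_def u_def)
qed

text \<open>The outer induction removes one map to obtain the correlations \<open>corr\<close>. The
  inner one splits one function at a time into its mean and a remainder of mean zero: the average
  with the remainder tends to \<open>0\<close>, and once all coordinates are constant the average
  equals its limit.\<close>

theorem multi_average_L2:
  fixes f :: "'i \<Rightarrow> 'a \<Rightarrow> real"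
  assumes "prob_space M" and "mixing_family M I T"
    and "\<And>i. i \<in> I \<Longrightarrow> bounded_measurable M (f i)"
  shows "(\<lambda>N. \<integral>x. (multi_average I T f N x - (\<Prod>i\<in>I. integral\<^sup>L M (f i)))\<^sup>2 \<partial>M) \<longlonglongrightarrow> 0"
  using assms(2,3)
proof (induction "card I" arbitrary: I T f)
  case 0
  then have I: "I = {}" by (simp add: mixing_family_def)
  \<comment> \<open>The empty product makes the average \<open>1\<close> for
    \<open>N \<ge> 1\<close>, but it is \<open>0\<close> at \<open>N = 0\<close>.\<close>
  have "eventually (\<lambda>N. (\<integral>x. (multi_average I T f N x - (\<Prod>i\<in>I. integral\<^sup>L M (f i)))\<^sup>2 \<partial>M) = 0) sequentially"
    by (rule eventually_sequentiallyI[of 1]) (simp add: I multi_average_def)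
  then show ?case by (rule tendsto_eventually)
next
  case (Suc n I T f)
  interpret prob_space M by fact
  have fin: "finite I" using Suc.prems by (simp add: mixing_family_def)
  have mp: "measure_preserving M (T i)" if "i \<in> I" for i
    using Suc.prems that by (auto simp: mixing_family_def invertible_mpt_def)
  obtain j where j: "j \<in> I" using Suc.hyps(2) by (metis card.empty equals0I nat.distinct(1))
  have corr: "(\<lambda>N. (\<Sum>n<N. \<integral>x. (\<Prod>i\<in>I. g i ((T i ^^ n) x)) \<partial>M) / real N)
      \<longlonglongrightarrow> (\<Prod>i\<in>I. integral\<^sup>L M (g i))"
    if "\<And>i. i \<in> I \<Longrightarrow> bounded_measurable M (g i)" for g :: "'i \<Rightarrow> 'a \<Rightarrow> real"
  proof (rule correlation_limit[OF assms(1) Suc.prems(1) j])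
    show "(\<lambda>N. \<integral>x. (multi_average (I - {j}) (\<lambda>i. T i \<circ> inv (T j)) g N x
        - (\<Prod>i\<in>I - {j}. integral\<^sup>L M (g i)))\<^sup>2 \<partial>M) \<longlonglongrightarrow> 0"
      using that Suc.hyps(2) j fin
      by (intro Suc.hyps(1) mixing_family_difference[OF Suc.prems(1)]) auto
  qed (use that in auto)
  \<comment> \<open>\<open>J\<close> collects the coordinates that may still be nonconstant.\<close>
  have "(\<lambda>N. \<integral>x. (multi_average I T g N x - (\<Prod>i\<in>I. integral\<^sup>L M (g i)))\<^sup>2 \<partial>M) \<longlonglongrightarrow> 0"
    if "finite J" "J \<subseteq> I" "\<And>i. i \<in> I \<Longrightarrow> bounded_measurable M (g i)"
      "\<And>i. i \<in> I - J \<Longrightarrow> \<exists>c. g i = (\<lambda>_. c)" for J and g :: "'i \<Rightarrow> 'a \<Rightarrow> real"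
    using that
  proof (induction J arbitrary: g rule: finite_induct)
    case empty
    then obtain c where c: "\<And>i. i \<in> I \<Longrightarrow> g i = (\<lambda>_. c i)" by (metis Diff_empty)
    have "eventually (\<lambda>N. (\<integral>x. (multi_average I T g N x - (\<Prod>i\<in>I. integral\<^sup>L M (g i)))\<^sup>2 \<partial>M) = 0) sequentially"
      by (rule eventually_sequentiallyI[of 1])
        (simp add: c multi_average_def prob_space cong: prod.cong)
    then show ?case by (rule tendsto_eventually)
  next
    case (insert i J)
    have i: "i \<in> I" using insert by auto
    define c where "c = integral\<^sup>L M (g i)"
    define g0 g1 where "g0 = g(i := \<lambda>_. c)" and "g1 = g(i := \<lambda>x. g i x - c)"
    let ?L = "\<Prod>i\<in>I. integral\<^sup>L M (g i)"
    have bg: "bounded_measurable M (g l)" if "l \<in> I" for l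
      using insert.prems(2) that .
    have b0: "bounded_measurable M (g0 l)" and b1: "bounded_measurable M (g1 l)" if "l \<in> I" for l
      using that bg unfolding g0_def g1_def
      by (auto intro: bounded_measurable_const bounded_measurable_diff)
    have split: "multi_average I T g N x - ?L = (multi_average I T g0 N x - ?L) + multi_average I T g1 N x" for N x
      using multi_average_add[OF fin i, of T g "\<lambda>_. c" "\<lambda>x. g i x - c" N x]
      by (simp add: g0_def g1_def)
    have bA0: "bounded_measurable M (\<lambda>x. multi_average I T g0 N x - ?L)"
      and bA1: "bounded_measurable M (multi_average I T g1 N)" for N
      by (intro bounded_measurable_intros multi_average_bounded_measurable mp b0 b1; assumption)+
    have L: "(\<Prod>i\<in>I. integral\<^sup>L M (g0 i)) = ?L"
      by (intro prod.cong) (auto simp: g0_def c_def prob_space)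
    have "(\<lambda>N. \<integral>x. (multi_average I T g0 N x - (\<Prod>i\<in>I. integral\<^sup>L M (g0 i)))\<^sup>2 \<partial>M) \<longlonglongrightarrow> 0"
      by (rule insert.IH) (use insert.prems b0 in \<open>auto simp: g0_def\<close>)
    then have lim0: "(\<lambda>N. \<integral>x. (multi_average I T g0 N x - ?L)\<^sup>2 \<partial>M) \<longlonglongrightarrow> 0"
      unfolding L .
    have "integral\<^sup>L M (g1 i) = 0"
      using bounded_measurable_integrable[OF bg[OF i]] by (simp add: g1_def c_def prob_space)
    then have lim1: "(\<lambda>N. \<integral>x. (multi_average I T g1 N x)\<^sup>2 \<partial>M) \<longlonglongrightarrow> 0"
      by (intro multi_average_zero_mean[OF assms(1) Suc.prems(1) corr b1 i])
    have "(\<lambda>N. 2 * (\<integral>x. (multi_average I T g0 N x - ?L)\<^sup>2 \<partial>M)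
        + 2 * (\<integral>x. (multi_average I T g1 N x)\<^sup>2 \<partial>M)) \<longlonglongrightarrow> 2 * 0 + 2 * 0"
      by (intro tendsto_intros lim0 lim1)
    then have "(\<lambda>N. 2 * (\<integral>x. (multi_average I T g0 N x - ?L)\<^sup>2 \<partial>M)
        + 2 * (\<integral>x. (multi_average I T g1 N x)\<^sup>2 \<partial>M)) \<longlonglongrightarrow> 0" by simp
    then show ?case
      unfolding split
      by (rule tendsto_sandwich[OF always_eventually always_eventually tendsto_const, rotated 2])
        (auto intro: integral_add_power2_le[OF bA0 bA1])
  qed
  from this[OF fin order_refl Suc.prems(2)] show ?case by simp
qed

subsection \<open>Almost everywhere convergence along a subsequence\<close>

lemma countably_dense_borel:
  fixes P :: "'a::polish_space measure"
  assumes "prob_space P" and sets: "sets P = sets borel"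
  shows "\<exists>\<A>. countably_dense P \<A>"
proof -
  interpret prob_space P by fact
  have space: "space P = UNIV" using sets_eq_imp_space_eq[OF sets] by simp
  obtain \<B> :: "'a set set" where \<B>: "countable \<B>" "topological_basis \<B>"
    using ex_countable_basis by blast
  have open_sets: "U \<in> sets P" if "open U" for U
    using that by (simp add: sets)
  have \<B>_open: "open b" if "b \<in> \<B>" for b
    using \<B>(2) that by (rule topological_basis_open)
  \<comment> \<open>Open sets approximate \<open>B\<close> from outside by regularity, and an open
    set is an increasing union of finite unions of basis elements; each of the two approximations
    may cost \<open>e / 2\<close>.\<close>
  let ?\<A> = "Union ` {F. finite F \<and> F \<subseteq> \<B>}"
  have opn: "open V" if "V \<in> ?\<A>" for V
    using that \<B>_open by (auto intro!: open_Union)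
  have "\<exists>V\<in>?\<A>. (\<integral>x. \<bar>indicator B x - indicator V x\<bar> \<partial>P) < e"
    if B: "B \<in> sets P" and e: "e > 0" for B and e :: real
  proof -
    have "emeasure P B = (INF U \<in> {U. B \<subseteq> U \<and> open U}. emeasure P U)"
      using B by (intro outer_regular) (auto simp: sets emeasure_eq_measure)
    moreover have "emeasure P B < ennreal (measure P B + e / 2)"
      using e unfolding emeasure_eq_measure by (intro ennreal_lessI) (auto intro: add_nonneg_pos)
    ultimately obtain U where U: "B \<subseteq> U" "open U" "emeasure P U < ennreal (measure P B + e / 2)"
      by (auto simp: INF_less_iff)
    have UP: "U \<in> sets P" using U(2) by (rule open_sets)
    have "measure P U < measure P B + e / 2"
      using U(3) e unfolding emeasure_eq_measure by (subst (asm) ennreal_less_iff) auto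
    then have UB: "measure P (U - B) < e / 2"
      using finite_measure_Diff[OF UP B U(1)] by simp
    obtain C where C: "C \<subseteq> \<B>" "\<Union>C = U"
      using \<B>(2) U(2) unfolding topological_basis_def by blast
    obtain V where V: "V \<in> ?\<A>" "V \<subseteq> U" "measure P (U - V) < e / 2"
    proof (cases "C = {}")
      case True
      then have "U = {}" using C(2) by simp
      moreover have "{} \<in> ?\<A>" by (rule image_eqI[of _ _ "{}"]) auto
      ultimately show ?thesis using that[of "{}"] e by simp
    next
      case False
      have Cc: "countable C" using countable_subset[OF C(1) \<B>(1)] .
      define V where "V n = \<Union>(from_nat_into C ` {..n})" for n :: nat
      have sub: "from_nat_into C ` {..n} \<subseteq> C" for n
        using False by (auto intro: from_nat_into)
      have VA: "V n \<in> ?\<A>" for n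
        unfolding V_def using sub[of n] C(1) by (intro imageI) auto
      have "(\<Union>n. V n) = \<Union>(range (from_nat_into C))" unfolding V_def by blast
      then have UV: "(\<Union>n. V n) = U" using range_from_nat_into[OF False Cc] C(2) by simp
      have "(\<lambda>n. measure P (V n)) \<longlonglongrightarrow> measure P (\<Union>n. V n)"
      proof (rule finite_Lim_measure_incseq)
        show "range V \<subseteq> sets P" using VA opn open_sets by blast
        show "incseq V" unfolding V_def incseq_def by (intro allI impI Union_mono image_mono) auto
      qed
      moreover have "measure P U - e / 2 < measure P U" using e by simp
      ultimately have "eventually (\<lambda>n. measure P U - e / 2 < measure P (V n)) sequentially"
        unfolding UV by (rule order_tendstoD)
      then obtain n where n: "measure P U - e / 2 < measure P (V n)"
        by (auto simp: eventually_sequentially)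
      have "V n \<subseteq> U" using UV by blast
      then have "measure P (U - V n) < e / 2"
        using n finite_measure_Diff[OF UP open_sets[OF opn[OF VA]] \<open>V n \<subseteq> U\<close>] by linarith
      then show ?thesis by (rule that[OF VA \<open>V n \<subseteq> U\<close>])
    qed
    have VP: "V \<in> sets P" using opn[OF V(1)] by (rule open_sets)
    \<comment> \<open>Both \<open>B\<close> and \<open>V\<close> lie in \<open>U\<close>, so they
      can differ only where one of them falls short of \<open>U\<close>.\<close>
    have "(\<integral>x. \<bar>indicator B x - indicator V x\<bar> \<partial>P) \<le> (\<integral>x. indicator (U - B) x + indicator (U - V) x \<partial>P :: real)"
    proof (rule integral_mono)
      show "integrable P (\<lambda>x. \<bar>indicator B x - indicator V x\<bar> :: real)"
        using B VP by (intro integrable_bounded[where C = 1]) (auto simp: indicator_def)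
      show "integrable P (\<lambda>x. indicator (U - B) x + indicator (U - V) x :: real)"
        using B VP UP by (intro integrable_bounded[where C = 2]) (auto simp: indicator_def)
    qed (use U(1) V(2) in \<open>auto simp: indicator_def\<close>)
    also have "\<dots> = measure P (U - B) + measure P (U - V)"
      using B VP UP by (subst Bochner_Integration.integral_add) (auto simp: space emeasure_eq_measure)
    also have "\<dots> < e" using UB V(3) by simp
    finally show ?thesis using V(1) by blast
  qed
  moreover have "countable ?\<A>"
    using \<B>(1) by (intro countable_image countable_Collect_finite_subset)
  moreover have "?\<A> \<subseteq> sets P" using opn open_sets by blast
  ultimately show ?thesis unfolding countably_dense_def by blast
qed

text \<open>A set in the completion differs from a set of \<open>P\<close> by a subset of a null
  set, which changes no \<open>L\<^sup>1\<close> distance.\<close>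

lemma countably_dense_completion:
  assumes "prob_space P" and \<A>: "countably_dense P \<A>"
  shows "countably_dense (completion P) \<A>"
  unfolding countably_dense_def
proof (intro conjI ballI allI impI)
  show "countable \<A>" "\<A> \<subseteq> sets (completion P)"
    using \<A> by (auto simp: countably_dense_def)
  fix B and e :: real assume "B \<in> sets (completion P)" and e: "0 < e"
  from this(1) obtain S N N' where S: "B = S \<union> N" "N \<subseteq> N'" "N' \<in> null_sets P" "S \<in> sets P"
    by (rule sets_completionE)
  obtain U where U: "U \<in> \<A>" "(\<integral>x. \<bar>indicator S x - indicator U x\<bar> \<partial>P) < e"
    using \<A> S(4) e unfolding countably_dense_def by blast
  have [measurable]: "S \<in> sets P" "U \<in> sets P"
    using S(4) U(1) \<A> by (auto simp: countably_dense_def)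
  have "(\<integral>x. \<bar>indicator B x - indicator U x\<bar> \<partial>completion P) =
      (\<integral>x. \<bar>indicator S x - indicator U x\<bar> \<partial>completion P :: real)"
  proof (rule integral_cong_AE)
    have "AE x in completion P. x \<notin> N'"
      using null_sets_completionI[OF S(3)] by (rule AE_not_in)
    then show "AE x in completion P. \<bar>indicator B x - indicator U x :: real\<bar> = \<bar>indicator S x - indicator U x\<bar>"
      by eventually_elim (use S in \<open>auto simp: indicator_def\<close>)
  qed (use \<open>B \<in> _\<close> in \<open>auto intro!: borel_measurable_abs borel_measurable_diff borel_measurable_indicator sets_completionI_sets\<close>)
  also have "\<dots> = (\<integral>x. \<bar>indicator S x - indicator U x\<bar> \<partial>P)"
    by (intro integral_completion) measurable
  finally have "(\<integral>x. \<bar>indicator B x - indicator U x\<bar> \<partial>completion P) < e"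
    using U(2) by simp
  then show "\<exists>U\<in>\<A>. (\<integral>x. \<bar>indicator B x - indicator U x\<bar> \<partial>completion P) < e"
    using U(1) by blast
qed

section \<open>Choice of the subsequence\<close>

lemma diagonal_subsequence:
  fixes D :: "nat \<Rightarrow> nat \<Rightarrow> real"
  assumes D: "\<And>j. D j \<longlonglongrightarrow> 0"
  shows "\<exists>N. strict_mono N \<and> (\<forall>l. 0 < N l) \<and> (\<forall>l. \<forall>j\<le>l. D j (N l) \<le> (1/2) ^ l)"
proof -
  \<comment> \<open>The bound \<open>(1/2) ^ l\<close> is chosen to be summable in \<open>l\<close>.
    Restricting to \<open>j \<le> l\<close> leaves finitely many constraints at each stage, while
    every \<open>D j\<close> is covered from stage \<open>j\<close> on.\<close>
  have ex: "\<exists>n>m. \<forall>j\<le>l. D j n \<le> (1/2) ^ l" for l m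
  proof -
    have "eventually (\<lambda>n. \<forall>j\<in>{..l}. D j n < (1/2) ^ l) sequentially"
      by (intro eventually_ball_finite ballI order_tendstoD(2)[OF D]) auto
    then have "eventually (\<lambda>n. n > m \<and> (\<forall>j\<in>{..l}. D j n < (1/2) ^ l)) sequentially"
      using eventually_gt_at_top[of m] by eventually_elim auto
    then show ?thesis by (auto simp: eventually_sequentially intro: less_imp_le)
  qed
  have "\<exists>N. \<forall>l. (0 < N l \<and> (\<forall>j\<le>l. D j (N l) \<le> (1/2) ^ l)) \<and> N l < N (Suc l)"
  proof (rule dependent_nat_choice)
    show "\<exists>n. 0 < n \<and> (\<forall>j\<le>0. D j n \<le> (1/2) ^ 0)"
      using ex[of 0 0] by blast
    show "\<exists>n. (0 < n \<and> (\<forall>j\<le>Suc l. D j n \<le> (1/2) ^ Suc l)) \<and> m < n"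
      if "0 < m \<and> (\<forall>j\<le>l. D j m \<le> (1/2) ^ l)" for l m
    proof -
      obtain n where "n > m" "\<forall>j\<le>Suc l. D j n \<le> (1/2) ^ Suc l" using ex[of m "Suc l"] by blast
      then show ?thesis by (intro exI[of _ n]) auto
    qed
  qed
  then show ?thesis by (auto simp: strict_mono_Suc_iff)
qed

text \<open>Nonnegative functions with summable integrals have an almost everywhere finite sum, so
  their values tend to \<open>0\<close>. The bound holds only from \<open>j\<close> on, hence the
  shifted sums.\<close>

lemma AE_tendsto_zero_of_integral_le:
  fixes w :: "nat \<Rightarrow> 'a \<Rightarrow> real"
  assumes int: "\<And>l. integrable M (w l)" and nonneg: "\<And>l x. w l x \<ge> 0"
    and le: "\<And>l. l \<ge> j \<Longrightarrow> (\<integral>x. w l x \<partial>M) \<le> (1/2) ^ l"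
  shows "AE x in M. (\<lambda>l. w l x) \<longlonglongrightarrow> 0"
proof -
  have [measurable]: "w l \<in> borel_measurable M" for l using int by auto
  have "(\<integral>\<^sup>+x. (\<Sum>l. ennreal (w (l + j) x)) \<partial>M) = (\<Sum>l. \<integral>\<^sup>+x. ennreal (w (l + j) x) \<partial>M)"
    by (intro nn_integral_suminf) simp
  also have "\<dots> \<le> (\<Sum>l. ennreal ((1/2) ^ (l + j)))"
    using int nonneg le by (intro suminf_le summableI) (auto simp: nn_integral_eq_integral intro!: ennreal_leI)
  also have "\<dots> = ennreal (\<Sum>l. (1/2) ^ (l + j))"
    by (intro suminf_ennreal2 summable_ignore_initial_segment summable_geometric) auto
  also have "\<dots> < \<infinity>" by simp
  finally have "AE x in M. (\<Sum>l. ennreal (w (l + j) x)) \<noteq> \<infinity>"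
    by (intro nn_integral_PInf_AE) auto
  then show ?thesis
  proof eventually_elim
    case (elim x)
    then have "summable (\<lambda>l. w (l + j) x)"
      using nonneg by (intro summable_suminf_not_top) auto
    then have "(\<lambda>l. w (l + j) x) \<longlonglongrightarrow> 0" by (rule summable_LIMSEQ_zero)
    then show ?case by (rule LIMSEQ_offset)
  qed
qed

definition averages_converge ::
  "'a measure \<Rightarrow> 'i set \<Rightarrow> ('i \<Rightarrow> 'a \<Rightarrow> 'a) \<Rightarrow> (nat \<Rightarrow> nat) \<Rightarrow> ('i \<Rightarrow> 'a \<Rightarrow> complex) \<Rightarrow> bool" where
  "averages_converge M I T N f \<longleftrightarrow>
     (AE x in M. (\<lambda>l. multi_average I T f (N l) x) \<longlonglongrightarrow> (\<Prod>i\<in>I. integral\<^sup>L M (f i)))"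

text \<open>The choice of \<open>N\<close> is made here. Tuples from a countable family over a
  finite index set form a countable set, and each contributes one sequence of squared
  \<open>L\<^sup>2\<close> errors to the diagonal argument.\<close>

lemma averages_converge_indicators:
  assumes "prob_space M" and fam: "mixing_family M I T" and \<A>: "countable \<A>" "\<A> \<subseteq> sets M" "\<A> \<noteq> {}"
  shows "\<exists>N. strict_mono N \<and> (\<forall>l. 0 < N l) \<and>
    (\<forall>U. (\<forall>i\<in>I. U i \<in> \<A>) \<longrightarrow> averages_converge M I T N (\<lambda>i. indicator (U i)))"
proof -
  interpret prob_space M by fact
  have fin: "finite I" using fam by (simp add: mixing_family_def)
  have mp: "measure_preserving M (T i)" if "i \<in> I" for i
    using fam that by (auto simp: mixing_family_def invertible_mpt_def)
  \<comment> \<open>Extensional functions: arbitrary values outside \<open>I\<close> could make the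
    set of tuples uncountable.\<close>
  define \<W> where "\<W> = PiE I (\<lambda>_. \<A>)"
  have \<W>: "countable \<W>" "\<W> \<noteq> {}"
    using \<A> fin by (auto simp: \<W>_def PiE_eq_empty_iff intro!: countable_PiE)
  define W where "W = from_nat_into \<W>"
  have W: "W j i \<in> \<A>" if "i \<in> I" for i j
    using from_nat_into[OF \<W>(2), of j] that by (auto simp: W_def \<W>_def PiE_def Pi_def)
  define d where "d j n x = (multi_average I T (\<lambda>i. indicator (W j i)) n x
      - (\<Prod>i\<in>I. measure M (W j i)))\<^sup>2" for j n x
  have bW: "bounded_measurable M (indicator (W j i) :: 'a \<Rightarrow> real)" if "i \<in> I" for i j
    using subsetD[OF \<A>(2) W[OF that, of j]] by (intro bounded_measurableI[where C = 1]) auto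
  have intW: "integral\<^sup>L M (indicator (W j i)) = measure M (W j i)" if "i \<in> I" for i j
    using W[OF that, of j] \<A>(2) sets.sets_into_space by (simp add: Int_absorb2 subset_iff)
  have "(\<lambda>n. \<integral>x. d j n x \<partial>M) \<longlonglongrightarrow> 0" for j
    using multi_average_L2[OF assms(1) fam, of "\<lambda>i. indicator (W j i)", OF bW]
    by (simp only: d_def intW cong: prod.cong)
  from diagonal_subsequence[of "\<lambda>j n. \<integral>x. d j n x \<partial>M", OF this]
  obtain N where N: "strict_mono N" "\<And>l. 0 < N l" "\<And>l j. j \<le> l \<Longrightarrow> (\<integral>x. d j (N l) x \<partial>M) \<le> (1/2) ^ l"
    by blast
  have conv: "averages_converge M I T N (\<lambda>i. indicator (W j i))" for j
  proof -
    have "AE x in M. (\<lambda>l. d j (N l) x) \<longlonglongrightarrow> 0"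
    proof (rule AE_tendsto_zero_of_integral_le[of _ _ j])
      show "integrable M (d j (N l))" for l
        unfolding d_def
        by (intro bounded_measurable_integrable bounded_measurable_intros multi_average_bounded_measurable mp bW)
      show "(\<integral>x. d j (N l) x \<partial>M) \<le> (1/2) ^ l" if "j \<le> l" for l
        using N(3)[OF that] .
    qed (simp add: d_def)
    then show ?thesis
      unfolding averages_converge_def
    proof eventually_elim
      case (elim x)
      then have "(\<lambda>l. multi_average I T (\<lambda>i. indicator (W j i)) (N l) x - (\<Prod>i\<in>I. measure M (W j i))) \<longlonglongrightarrow> 0"
        by (simp add: d_def)
      then have "(\<lambda>l. multi_average I T (\<lambda>i. indicator (W j i)) (N l) x) \<longlonglongrightarrow> (\<Prod>i\<in>I. measure M (W j i))"
        by (rule LIM_zero_cancel)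
      \<comment> \<open>Mean convergence was real-valued, whereas \<open>averages_converge\<close>
        speaks of complex functions.\<close>
      then have "(\<lambda>l. complex_of_real (multi_average I T (\<lambda>i. indicator (W j i)) (N l) x))
          \<longlonglongrightarrow> complex_of_real (\<Prod>i\<in>I. measure M (W j i))"
        by (rule tendsto_of_real)
      moreover have "complex_of_real (multi_average I T (\<lambda>i. indicator (W j i)) n x)
          = multi_average I T (\<lambda>i. indicator (W j i)) n x" for n
        by (simp add: multi_average_def of_real_indicator)
      moreover have "complex_of_real (\<Prod>i\<in>I. measure M (W j i)) = (\<Prod>i\<in>I. integral\<^sup>L M (indicator (W j i)))"
        unfolding of_real_prod
      proof (rule prod.cong[OF refl])
        fix i assume "i \<in> I"
        from intW[OF this, of j] integral_complex_of_real[of M "indicator (W j i)"]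
        show "complex_of_real (measure M (W j i)) = integral\<^sup>L M (indicator (W j i))"
          by (simp only: of_real_indicator)
      qed
      ultimately show ?case by simp
    qed
  qed
  have "averages_converge M I T N (\<lambda>i. indicator (U i))" if U: "\<forall>i\<in>I. U i \<in> \<A>" for U
  proof -
    have "restrict U I \<in> \<W>" using U by (auto simp: \<W>_def)
    then obtain j where "W j = restrict U I"
      using from_nat_into_surj[OF \<W>(1)] by (auto simp: W_def)
    then have WU: "W j i = U i" if "i \<in> I" for i using that by simp
    show ?thesis
      using conv[of j] by (simp add: averages_converge_def multi_average_def WU cong: prod.cong)
  qed
  then show ?thesis using N by blast
qed

section \<open>Extension from indicators to bounded functions\<close>

lemma multi_average_scale:
  fixes f :: "'i \<Rightarrow> 'a \<Rightarrow> 'b::real_normed_field"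
  assumes "finite I" "i \<in> I"
  shows "multi_average I T (f(i := \<lambda>x. c * g x)) N x = c * multi_average I T (f(i := g)) N x"
proof -
  have "(\<Prod>l\<in>I. (f(i := q)) l ((T l ^^ n) x)) = q ((T i ^^ n) x) * (\<Prod>l\<in>I - {i}. f l ((T l ^^ n) x))"
    for q n
    using assms by (simp add: prod.remove)
  then show ?thesis
    by (simp add: multi_average_def sum_distrib_left mult.assoc)
qed

lemma averages_converge_scale:
  assumes "finite I" "i \<in> I" "averages_converge M I T N (f(i := g))"
  shows "averages_converge M I T N (f(i := \<lambda>x. c * g x))"
  using assms(3) unfolding averages_converge_def prod_integral_upd[OF assms(1,2)]
    multi_average_scale[OF assms(1,2)]
  by eventually_elim (auto simp: mult.assoc intro!: tendsto_mult_left)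

lemma averages_converge_add:
  assumes "finite I" "i \<in> I" "integrable M g" "integrable M h"
    and "averages_converge M I T N (f(i := g))" "averages_converge M I T N (f(i := h))"
  shows "averages_converge M I T N (f(i := \<lambda>x. g x + h x))"
  using assms(5,6) unfolding averages_converge_def prod_integral_upd[OF assms(1,2)]
    multi_average_add[OF assms(1,2)]
proof eventually_elim
  case (elim x)
  from tendsto_add[OF this] show ?case using assms(3,4) by (simp add: distrib_right)
qed

text \<open>The other coordinates have a product bounded by \<open>K\<close>, so the averages for
  \<open>g\<close> and \<open>s m\<close> differ by at most \<open>K\<close> times a Birkhoff
  average of \<open>norm (g x - s m x)\<close> under \<open>T i\<close>. This tends to
  \<open>\<delta> m\<close> along all integers, hence along \<open>N\<close>. Only integrability is
  asked of coordinate \<open>i\<close>, so limits in \<open>L\<^sup>1\<close> are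
  admissible.\<close>

lemma averages_converge_limit:
  assumes "prob_space M" and I: "finite I" "i \<in> I" and erg: "ergodic M (T i)" and N: "strict_mono N"
    and f: "\<And>l. l \<in> I - {i} \<Longrightarrow> bounded_measurable M (f l)"
    and g: "integrable M g" and s: "\<And>m. integrable M (s m)"
    and conv: "\<And>m. averages_converge M I T N (f(i := s m))"
    and lim: "(\<lambda>m::nat. \<integral>x. norm (g x - s m x) \<partial>M) \<longlonglongrightarrow> 0"
  shows "averages_converge M I T N (f(i := g))"
proof -
  interpret prob_space M by fact
  have "\<forall>l\<in>I - {i}. \<exists>C>0. \<forall>x. norm (f l x) \<le> C"
    using f bounded_measurable_bound by metis
  then obtain C where C: "\<And>l. l \<in> I - {i} \<Longrightarrow> C l > 0" "\<And>l x. l \<in> I - {i} \<Longrightarrow> norm (f l x) \<le> C l"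
    by metis
  define K where "K = (\<Prod>l\<in>I - {i}. C l)"
  have K: "K > 0" unfolding K_def using C(1) by (intro prod_pos) auto
  have prod_le: "norm (\<Prod>l\<in>I - {i}. z l) \<le> K" if "\<And>l. l \<in> I - {i} \<Longrightarrow> norm (z l) \<le> C l" for z :: "_ \<Rightarrow> complex"
    unfolding K_def prod_norm[symmetric] using that by (intro prod_mono) auto
  define \<delta> where "\<delta> m = (\<integral>x. norm (g x - s m x) \<partial>M)" for m
  let ?L = "\<lambda>q. \<Prod>l\<in>I. integral\<^sup>L M ((f(i := q)) l)"
  have int_le: "norm (integral\<^sup>L M (f l)) \<le> C l" if "l \<in> I - {i}" for l
  proof -
    have "norm (integral\<^sup>L M (f l)) \<le> (\<integral>x. norm (f l x) \<partial>M)" by (rule integral_norm_bound)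
    also have "\<dots> \<le> (\<integral>x. C l \<partial>M)"
      using C(2)[OF that] bounded_measurable_integrable[OF f[OF that]] by (intro integral_mono) auto
    finally show ?thesis by (simp add: prob_space)
  qed
  have L_diff: "norm (?L g - ?L (s m)) \<le> K * \<delta> m" for m
  proof -
    have "?L g - ?L (s m) = (\<integral>x. g x - s m x \<partial>M) * (\<Prod>l\<in>I - {i}. integral\<^sup>L M (f l))"
      unfolding prod_integral_upd[OF I] using g s[of m] by (simp add: left_diff_distrib)
    moreover have "norm (\<integral>x. g x - s m x \<partial>M) \<le> \<delta> m"
      unfolding \<delta>_def by (rule integral_norm_bound)
    ultimately show ?thesis
      using mult_mono[OF _ prod_le[OF int_le], of "norm (\<integral>x. g x - s m x \<partial>M)" "\<delta> m"]
      by (simp add: norm_mult mult.commute \<delta>_def)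
  qed
  have A_diff: "norm (multi_average I T (f(i := g)) n x - multi_average I T (f(i := s m)) n x)
      \<le> K * ((\<Sum>r<n. norm (g ((T i ^^ r) x) - s m ((T i ^^ r) x))) / real n)" for m n x
  proof -
    have "multi_average I T (f(i := g)) n x - multi_average I T (f(i := s m)) n x
        = multi_average I T (f(i := \<lambda>x. g x - s m x)) n x"
      using multi_average_add[OF I, of T f "s m" "\<lambda>x. g x - s m x" n x] by simp
    also have "\<dots> = (\<Sum>r<n. (g ((T i ^^ r) x) - s m ((T i ^^ r) x)) * (\<Prod>l\<in>I - {i}. f l ((T l ^^ r) x))) / of_nat n"
      unfolding multi_average_def using I by (simp add: prod.remove)
    also have "norm \<dots> \<le> (\<Sum>r<n. norm (g ((T i ^^ r) x) - s m ((T i ^^ r) x)) * K) / real n"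
    proof -
      have "norm ((g ((T i ^^ r) x) - s m ((T i ^^ r) x)) * (\<Prod>l\<in>I - {i}. f l ((T l ^^ r) x)))
          \<le> norm (g ((T i ^^ r) x) - s m ((T i ^^ r) x)) * K" for r
        unfolding norm_mult using C by (intro mult_left_mono prod_le) auto
      then show ?thesis
        unfolding norm_divide norm_of_nat by (intro divide_right_mono order_trans[OF norm_sum sum_mono]) auto
    qed
    finally show ?thesis by (simp add: sum_distrib_left mult.commute)
  qed
  have "AE x in M. (\<lambda>n. (\<Sum>r<n. norm (g ((T i ^^ r) x) - s m ((T i ^^ r) x))) / real n) \<longlonglongrightarrow> \<delta> m" for m
    unfolding \<delta>_def using g s[of m] by (intro birkhoff_ergodic[OF assms(1) erg, of "\<lambda>x. norm (g x - s m x)"]) auto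
  then have bk: "AE x in M. \<forall>m. (\<lambda>n. (\<Sum>r<n. norm (g ((T i ^^ r) x) - s m ((T i ^^ r) x))) / real n) \<longlonglongrightarrow> \<delta> m"
    by (simp add: AE_all_countable)
  have cv: "AE x in M. \<forall>m. (\<lambda>l. multi_average I T (f(i := s m)) (N l) x) \<longlonglongrightarrow> ?L (s m)"
    unfolding AE_all_countable using conv unfolding averages_converge_def by blast
  show ?thesis
    unfolding averages_converge_def
    using bk cv
  proof eventually_elim
    case (elim x)
    let ?B = "\<lambda>m n. (\<Sum>r<n. norm (g ((T i ^^ r) x) - s m ((T i ^^ r) x))) / real n"
    show ?case
    proof (rule LIM_zero_cancel, rule tendsto_norm_zero_cancel, rule order_tendstoI)
      fix e :: real assume e: "0 < e"
      then have "e / (2 * K) > 0" using K by simp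
      with lim have "eventually (\<lambda>m. \<delta> m < e / (2 * K)) sequentially"
        unfolding \<delta>_def by (rule order_tendstoD)
      then obtain m where "\<delta> m < e / (2 * K)" by (auto simp: eventually_sequentially)
      \<comment> \<open>The summands are the limits of three errors: between the averages for
        \<open>g\<close> and \<open>s m\<close>, in the convergence for \<open>s m\<close>, and
        between the two candidate limits.\<close>
      then have m: "K * \<delta> m + 0 + K * \<delta> m < e" using K by (simp add: field_simps)
      have "(\<lambda>l. ?B m (N l)) \<longlonglongrightarrow> \<delta> m"
        using LIMSEQ_subseq_LIMSEQ[OF elim(1)[rule_format, of m] N] by (simp add: comp_def)
      moreover have "(\<lambda>l. norm (multi_average I T (f(i := s m)) (N l) x - ?L (s m))) \<longlonglongrightarrow> 0"
        using elim(2)[rule_format, of m] by (intro tendsto_norm_zero LIM_zero)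
      ultimately have "(\<lambda>l. K * ?B m (N l) + norm (multi_average I T (f(i := s m)) (N l) x - ?L (s m)) + K * \<delta> m)
          \<longlonglongrightarrow> K * \<delta> m + 0 + K * \<delta> m"
        by (intro tendsto_add tendsto_mult_left tendsto_const)
      then have "eventually (\<lambda>l. K * ?B m (N l) + norm (multi_average I T (f(i := s m)) (N l) x - ?L (s m)) + K * \<delta> m < e) sequentially"
        using m by (rule order_tendstoD)
      then show "eventually (\<lambda>l. norm (multi_average I T (f(i := g)) (N l) x - ?L g) < e) sequentially"
      proof eventually_elim
        case (elim l)
        let ?a = "multi_average I T (f(i := g)) (N l) x" and ?b = "multi_average I T (f(i := s m)) (N l) x"
        have "norm (?a - ?L g) = norm ((?a - ?b) + (?b - ?L (s m)) - (?L g - ?L (s m)))" by simp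
        also have "\<dots> \<le> norm (?a - ?b) + norm (?b - ?L (s m)) + norm (?L g - ?L (s m))"
          by (rule order_trans[OF norm_triangle_ineq4 add_right_mono[OF norm_triangle_ineq]])
        finally show ?case using A_diff[of "N l" x m] L_diff[of m] elim by linarith
      qed
    next
      fix e :: real assume "e < 0"
      then show "eventually (\<lambda>l. e < norm (multi_average I T (f(i := g)) (N l) x - ?L g)) sequentially"
        by (intro always_eventually allI) (erule less_le_trans, rule norm_ge_zero)
    qed
  qed
qed

text \<open>Induction over integrable functions: indicators by density, then sums, then dominated
  limits of simple functions. Passage to \<open>L\<^sup>1\<close> limits settles the first and the
  last case.\<close>

lemma averages_converge_coordinate:
  assumes "prob_space M" and \<A>: "countably_dense M \<A>"
    and I: "finite I" "i \<in> I" and erg: "ergodic M (T i)" and N: "strict_mono N"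
    and f: "\<And>l. l \<in> I - {i} \<Longrightarrow> bounded_measurable M (f l)"
    and conv: "\<And>U. U \<in> \<A> \<Longrightarrow> averages_converge M I T N (f(i := indicator U))"
    and g: "integrable M g"
  shows "averages_converge M I T N (f(i := g))"
  using g
proof (induction rule: integrable_induct)
  case (base A c)
  interpret prob_space M by fact
  have "\<exists>U\<in>\<A>. (\<integral>x. \<bar>indicator A x - indicator U x\<bar> \<partial>M) < 1 / real (Suc m)" for m
    using \<A> base(1) unfolding countably_dense_def by simp
  then obtain U where U: "\<And>m. U m \<in> \<A>" "\<And>m. (\<integral>x. \<bar>indicator A x - indicator (U m) x\<bar> \<partial>M) < 1 / real (Suc m)"
    by metis
  have [measurable]: "U m \<in> sets M" "A \<in> sets M" for m
    using U(1) \<A> base(1) by (auto simp: countably_dense_def)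
  show ?case
  proof (rule averages_converge_limit[where T = T and i = i, OF assms(1) I erg N f])
    show "integrable M (\<lambda>x. indicator A x *\<^sub>R c)" using base by simp
    show "integrable M (\<lambda>x. c * indicator (U m) x)" for m
    proof (intro bounded_measurable_integrable bounded_measurable_mult bounded_measurable_const)
      show "bounded_measurable M (indicator (U m) :: 'a \<Rightarrow> complex)"
        by (intro bounded_measurableI[where C = 1]) (auto simp: indicator_def)
    qed
    show "averages_converge M I T N (f(i := \<lambda>x. c * indicator (U m) x))" for m
      using averages_converge_scale[OF I conv[OF U(1)]] .
    have "(\<integral>x. norm (indicator A x *\<^sub>R c - c * indicator (U m) x) \<partial>M) = norm c * (\<integral>x. \<bar>indicator A x - indicator (U m) x\<bar> \<partial>M)" for m
      unfolding integral_mult_right_zero[symmetric]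
      by (intro Bochner_Integration.integral_cong) (auto simp: indicator_def)
    moreover have "(\<lambda>m. norm c * (\<integral>x. \<bar>indicator A x - indicator (U m) x\<bar> \<partial>M)) \<longlonglongrightarrow> norm c * 0"
    proof (rule tendsto_mult_left)
      show "(\<lambda>m. \<integral>x. \<bar>indicator A x - indicator (U m) x :: real\<bar> \<partial>M) \<longlonglongrightarrow> 0"
        by (rule tendsto_sandwich[OF always_eventually always_eventually tendsto_const LIMSEQ_Suc[OF lim_1_over_n]])
          (use U(2) in \<open>auto intro: less_imp_le simp del: of_nat_Suc\<close>)
    qed
    ultimately show "(\<lambda>m. \<integral>x. norm (indicator A x *\<^sub>R c - c * indicator (U m) x) \<partial>M) \<longlonglongrightarrow> 0" by simp
  qed
next
  case (add g h)
  then show ?case using averages_converge_add[OF I] by blast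
next
  case (lim g s)
  show ?case
  proof (rule averages_converge_limit[where T = T and i = i, OF assms(1) I erg N f lim(4) lim(1) lim(5)])
    have [measurable]: "g \<in> borel_measurable M" "s m \<in> borel_measurable M" for m
      using lim(1,4) by auto
    have "(\<lambda>m. \<integral>x. norm (g x - s m x) \<partial>M) \<longlonglongrightarrow> (\<integral>x. 0 \<partial>M)"
    \<comment> \<open>The approximants satisfy \<open>norm (s m x) \<le> 2 * norm (g x)\<close>,
      whence the factor \<open>3\<close>.\<close>
    proof (rule integral_dominated_convergence[where w = "\<lambda>x. 3 * norm (g x)"])
      show "integrable M (\<lambda>x. 3 * norm (g x))" using lim(4) by simp
      show "AE x in M. (\<lambda>m. norm (g x - s m x)) \<longlonglongrightarrow> 0"
      proof (rule AE_I2)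
        fix x assume "x \<in> space M"
        from tendsto_diff[OF tendsto_const lim(2)[OF this], of "g x"]
        show "(\<lambda>m. norm (g x - s m x)) \<longlonglongrightarrow> 0" by (intro tendsto_norm_zero) simp
      qed
      show "AE x in M. norm (norm (g x - s m x)) \<le> 3 * norm (g x)" for m
      proof (rule AE_I2)
        fix x assume "x \<in> space M"
        from lim(3)[OF this, of m] norm_triangle_ineq4[of "g x" "s m x"]
        show "norm (norm (g x - s m x)) \<le> 3 * norm (g x)" by simp
      qed
    qed auto
    then show "(\<lambda>m. \<integral>x. norm (g x - s m x) \<partial>M) \<longlonglongrightarrow> 0" by simp
  qed
qed

text \<open>Coordinates are freed from indicators one after another, so that at each step all the
  others are bounded, some of them still being indicators.\<close>

lemma averages_converge_bounded:
  assumes "prob_space M" and \<A>: "countably_dense M \<A>"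
    and I: "finite I" and erg: "\<And>i. i \<in> I \<Longrightarrow> ergodic M (T i)" and N: "strict_mono N"
    and conv: "\<And>U. (\<forall>i\<in>I. U i \<in> \<A>) \<Longrightarrow> averages_converge M I T N (\<lambda>i. indicator (U i))"
    and f: "\<And>i. i \<in> I \<Longrightarrow> bounded_measurable M (f i)"
  shows "averages_converge M I T N f"
proof -
  interpret prob_space M by fact
  have "averages_converge M I T N f"
    if "finite J" "J \<subseteq> I" "\<And>i. i \<in> J \<Longrightarrow> bounded_measurable M (f i)"
      "\<And>i. i \<in> I - J \<Longrightarrow> \<exists>U\<in>\<A>. f i = indicator U" for J f
    using that
  proof (induction J arbitrary: f rule: finite_induct)
    case empty
    then have "\<forall>i\<in>I. \<exists>U. U \<in> \<A> \<and> f i = indicator U" by (simp add: Bex_def)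
    then obtain U where "\<forall>i\<in>I. U i \<in> \<A> \<and> f i = indicator (U i)"
      by (rule bchoice[THEN exE])
    then show ?case
      using conv[of U] by (simp add: averages_converge_def multi_average_def cong: prod.cong)
  next
    case (insert i J)
    have i: "i \<in> I" using insert.prems(1) by auto
    have ind: "bounded_measurable M (indicator U :: 'a \<Rightarrow> complex)" if "U \<in> \<A>" for U
      using \<A> that by (intro bounded_measurableI[where C = 1]) (auto simp: countably_dense_def indicator_def)
    \<comment> \<open>Writing \<open>f\<close> as an update of itself exposes the slot
      \<open>i\<close>: the induction hypothesis covers every \<open>f(i := indicator U)\<close>,
      and density does the rest.\<close>
    have "averages_converge M I T N (f(i := f i))"
    proof (rule averages_converge_coordinate[where T = T and i = i, OF assms(1) \<A> I i erg[OF i] N])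
      show "integrable M (f i)" using insert.prems(2)[of i] by (intro bounded_measurable_integrable) auto
      show "bounded_measurable M (f l)" if "l \<in> I - {i}" for l
        using insert.prems(2)[of l] insert.prems(3)[of l] ind that by (cases "l \<in> J") auto
      show "averages_converge M I T N (f(i := indicator U))" if "U \<in> \<A>" for U
        by (rule insert.IH) (use insert.prems insert.hyps that in auto)
    qed
    then show ?case by simp
  qed
  from this[OF I order_refl f] show ?thesis by simp
qed

theorem theorem2p2:
  fixes M :: "'a::polish_space measure" and T :: "nat \<Rightarrow> 'a \<Rightarrow> 'a" and k :: nat
  assumes "k \<ge> 1"
    and "lebesgue_prob_space M"
    and "\<And>i. i \<in> {1..k} \<Longrightarrow> invertible_mpt M (T i)"
    and "\<And>i j. i \<in> {1..k} \<Longrightarrow> j \<in> {1..k} \<Longrightarrow> T i \<circ> T j = T j \<circ> T i"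
    and "\<And>i. i \<in> {1..k} \<Longrightarrow> weakly_mixing M (T i)"
    and "\<And>i j. i \<in> {1..k} \<Longrightarrow> j \<in> {1..k} \<Longrightarrow> i \<noteq> j \<Longrightarrow> ergodic M (T i \<circ> inv (T j))"
  shows "\<exists>N :: nat \<Rightarrow> nat. strict_mono N \<and> (\<forall>l. 0 < N l) \<and>
    (\<forall>f :: nat \<Rightarrow> 'a \<Rightarrow> complex. (\<forall>i\<in>{1..k}. f i \<in> L_infinity M) \<longrightarrow>
      (AE x in M.
        (\<lambda>l. (\<Sum>n=1..N l. \<Prod>i=1..k. f i ((T i ^^ n) x)) / of_nat (N l))
          \<longlonglongrightarrow> (\<Prod>j=1..k. integral\<^sup>L M (f j))))"
proof -
  let ?I = "{1..k}"
  obtain P where P: "prob_space P" "sets P = sets borel" "M = completion P"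
    using assms(2) by (auto simp: lebesgue_prob_space_def)
  have prob: "prob_space M"
    using prob_space.prob_space_completion[OF P(1)] P(3) by simp
  obtain \<A> where \<A>: "countably_dense M \<A>"
    using countably_dense_borel[OF P(1,2)] countably_dense_completion[OF P(1)] P(3) by blast
  have \<A>_ne: "\<A> \<noteq> {}"
  proof
    assume "\<A> = {}"
    then show False
      using \<A> sets.empty_sets[of M] zero_less_one unfolding countably_dense_def by blast
  qed
  have mp: "measure_preserving M (T i)" if "i \<in> ?I" for i
    using assms(3)[OF that] by (simp add: invertible_mpt_def)
  have fam: "mixing_family M ?I T"
    unfolding mixing_family_def
  proof (intro conjI ballI impI)
    fix i assume i: "i \<in> ?I"
    show "ergodic (M \<Otimes>\<^sub>M M) (map_prod (T i) (T i))"
      by (rule ergodic_map_prod_self[OF prob \<A> weakly_mixing_ergodic[OF prob assms(5)[OF i]] assms(5)[OF i] refl])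
    fix j assume j: "j \<in> ?I" "i \<noteq> j"
    have "bij (T j)" using assms(3)[OF j(1)] by (simp add: invertible_mpt_def)
    note c = comp_inv_commute[OF this assms(4)[OF i j(1)]]
    \<comment> \<open>The weakly mixing map commuting with the ergodic quotient
      \<open>T i \<circ> inv (T j)\<close> is \<open>T i\<close> itself.\<close>
    have "(T i \<circ> inv (T j)) \<circ> T i = T i \<circ> (T i \<circ> inv (T j))"
      by (simp only: comp_assoc c[symmetric])
    then show "ergodic (M \<Otimes>\<^sub>M M) (map_prod (T i \<circ> inv (T j)) (T i \<circ> inv (T j)))"
      by (rule ergodic_map_prod_self[OF prob \<A> assms(6)[OF i j] assms(5)[OF i]])
  qed (use assms in auto)
  obtain N where N: "strict_mono N" "\<And>l. 0 < N l"
    "\<And>U. (\<forall>i\<in>?I. U i \<in> \<A>) \<Longrightarrow> averages_converge M ?I T N (\<lambda>i. indicator (U i))"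
    using averages_converge_indicators[OF prob fam _ _ \<A>_ne] \<A> unfolding countably_dense_def by blast
  have "AE x in M. (\<lambda>l. (\<Sum>n=1..N l. \<Prod>i=1..k. f i ((T i ^^ n) x)) / of_nat (N l))
      \<longlonglongrightarrow> (\<Prod>j=1..k. integral\<^sup>L M (f j))"
    if f: "\<forall>i\<in>?I. f i \<in> L_infinity M" for f :: "nat \<Rightarrow> 'a \<Rightarrow> complex"
  proof -
    have f_m: "f i \<in> borel_measurable M" if "i \<in> ?I" for i
      using f that by (auto simp: L_infinity_def)
    have "\<forall>i\<in>?I. \<exists>C. AE x in M. norm (f i x) \<le> C"
      using f by (auto simp: L_infinity_def)
    then obtain C where C: "\<And>i. i \<in> ?I \<Longrightarrow> AE x in M. norm (f i x) \<le> C i" by metis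
    \<comment> \<open>The estimates use bounds at every point, while \<open>f i\<close> is bounded
      only almost everywhere.\<close>
    define g where "g i x = (if norm (f i x) \<le> C i then f i x else 0)" for i x
    have bg: "bounded_measurable M (g i)" if "i \<in> ?I" for i
    proof (rule bounded_measurableI)
      note [measurable] = f_m[OF that]
      show "g i \<in> borel_measurable M" unfolding g_def[abs_def] by measurable
      show "norm (g i x) \<le> max 0 (C i)" for x by (auto simp: g_def)
    qed
    have fg: "AE x in M. f i x = g i x" if "i \<in> ?I" for i
      using C[OF that] by eventually_elim (simp add: g_def)
    \<comment> \<open>The composition with \<open>T i\<close> that shifts the summation range leaves
      the integrals unchanged by invariance.\<close>
    have int_eq: "integral\<^sup>L M (f i) = integral\<^sup>L M (\<lambda>x. g i (T i x))" if "i \<in> ?I" for i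
      using integral_cong_AE[OF f_m[OF that] bounded_measurableD[OF bg[OF that]] fg[OF that]]
        measure_preserving_integral[OF mp[OF that] bounded_measurableD[OF bg[OF that]]] by simp
    have "averages_converge M ?I T N (\<lambda>i x. g i (T i x))"
    proof (rule averages_converge_bounded[OF prob \<A> _ _ N(1) N(3)])
      show "ergodic M (T i)" if "i \<in> ?I" for i
        using weakly_mixing_ergodic[OF prob assms(5)[OF that]] .
      show "bounded_measurable M (\<lambda>x. g i (T i x))" if "i \<in> ?I" for i
        using bounded_measurable_comp[OF bg[OF that] measure_preservingD(1)[OF mp[OF that]]] .
    qed auto
    then have conv: "AE x in M. (\<lambda>l. multi_average ?I T (\<lambda>i x. g i (T i x)) (N l) x)
        \<longlonglongrightarrow> (\<Prod>j=1..k. integral\<^sup>L M (f j))"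
      unfolding averages_converge_def by (simp only: int_eq cong: prod.cong)
    \<comment> \<open>The set where \<open>f i\<close> and \<open>g i\<close> differ is pulled back
      along every iterate; countably many null sets arise.\<close>
    have "AE x in M. \<forall>i\<in>?I. \<forall>n. f i ((T i ^^ n) x) = g i ((T i ^^ n) x)"
      unfolding AE_ball_countable[OF countable_finite[OF finite_atLeastAtMost]] AE_all_countable
      using measure_preserving_AE[OF measure_preserving_funpow[OF mp] fg] by blast
    with conv show ?thesis
    proof eventually_elim
      case (elim x)
      have "f i ((T i ^^ Suc n) x) = g i (T i ((T i ^^ n) x))" if "i \<in> ?I" for i n
        using elim(2)[rule_format, OF that, of "Suc n"] by simp
      then have "(\<Prod>i=1..k. f i ((T i ^^ Suc n) x)) = (\<Prod>i=1..k. g i (T i ((T i ^^ n) x)))" for n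
        by (rule prod.cong[OF refl])
      then have "(\<Sum>n=1..m. \<Prod>i=1..k. f i ((T i ^^ n) x)) / of_nat m = multi_average ?I T (\<lambda>i x. g i (T i x)) m x" for m
        unfolding multi_average_def One_nat_def sum.atLeast1_atMost_eq by simp
      then show ?case using elim(1) by simp
    qed
  qed
  then show ?thesis using N(1,2) by blast
qed

end
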